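(* Let $k\ge 0$ and let $\pi$ be a set of $q$ pairwise disjoint two-element subsets of $\{1,\dots,k\}$; let $m=k-2q$ and let $i_1<\dots<i_m$ be the indices not belonging to any pair of $\pi$. For $n\ge 2$ let $F_{\pi,n}(x_{i_1},\dots,x_{i_m})$ be the $m$-linear form on $sl(n)$ obtained from the $k$-linear form $f(x_1,\dots,x_k)=\mathrm{Tr}(\mathrm{ad}_{x_1}\cdots \mathrm{ad}_{x_k})$ by contracting along all pairs of $\pi$. Then: (1) There are finitely many expressions $T$, each a product of traces of products of the matrices $x_{i_j}$ and $x_{i_j}^{*}$, and polynomials $p_T$ in one variable (depending only on $k$ and $\pi$, not on $n$) such that $F_{\pi,n}(x_{i_1},\dots,x_{i_m})=\sum_T p_T(n)\,T(x_{i_1},\dots,x_{i_m})$ for all $n\ge 2$ and all $x_{i_1},\dots,x_{i_m}\in sl(n)$. (2) The polynomials $p_T$ in this representation can be taken of degree at most $k+2$.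
   Context: Work over a field of characteristic $0$. $sl(n)$ is the Lie algebra of traceless $n\times n$ matrices, $\mathrm{ad}_x(u)=[x,u]=xu-ux$ on $sl(n)$, and $\mathrm{Tr}(\mathrm{ad}_{x_1}\cdots\mathrm{ad}_{x_k})$ is the trace of a linear operator on $sl(n)$ (for $k=0$ it is the trace of the identity operator, i.e. $n^2-1$). The form $f$ is the $k$-linear form associated with the diagram $L$ consisting of an oriented circle with $k$ outgoing tails. In the expressions $T$, traces are ordinary traces of $n\times n$ matrices, $x^{*}$ is the transpose of $x$, and the empty product of traces is $1$. Contracting along a pair $\{a,b\}$ means replacing the form by $\sum_{\alpha} f(\dots,\alpha,\dots,\tilde\alpha,\dots)$, where the arguments $x_a,x_b$ are replaced by $\alpha,\tilde\alpha$, $\alpha$ runs over a basis of $sl(n)$ and $\tilde\alpha$ over the corresponding dual basis with respect to the form $\langle X,Y\rangle=\mathrm{Tr}(XY)$ (trace of the $n\times n$ matrix). Contracting along $\pi$ means doing this for every pair of $\pi$. The result does not depend on the choice of basis. *)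

theory Defs
  imports "Jordan_Normal_Form.VS_Connect"
begin

definition mat_trace :: "'a::comm_monoid_add mat \<Rightarrow> 'a" where
  "mat_trace X = (\<Sum>i<dim_row X. X $$ (i, i))"

definition sl :: "nat \<Rightarrow> 'a::field mat set" where
  "sl n = {X \<in> carrier_mat n n. mat_trace X = 0}"

abbreviation sl_vs :: "nat \<Rightarrow> ('a::field, 'a mat) module" where
  "sl_vs n \<equiv> (module_mat TYPE('a) n n)\<lparr>carrier := sl n\<rparr>"

definition ad :: "'a::field mat \<Rightarrow> 'a mat \<Rightarrow> 'a mat" where
  "ad x u = x * u - u * x"

definition is_finite_basis :: "('a::field, 'v) module \<Rightarrow> 'v set \<Rightarrow> bool" where
  "is_finite_basis V B \<longleftrightarrow> finite B \<and> vectorspace.basis class_ring V B"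

text \<open>The coordinate function of \<open>v\<close> with respect to a finite basis \<open>B\<close>; existence and
  uniqueness are provided by \<open>vectorspace.basis_criterion\<close>.\<close>

definition coords :: "('a::field, 'v) module \<Rightarrow> 'v set \<Rightarrow> 'v \<Rightarrow> 'v \<Rightarrow> 'a" where
  "coords V B v = (THE c. c \<in> B \<rightarrow>\<^sub>E UNIV \<and> LinearCombinations.module.lincomb V c B = v)"

definition operator_trace :: "('a::field, 'v) module \<Rightarrow> ('v \<Rightarrow> 'v) \<Rightarrow> 'a" where
  "operator_trace V A =
     (let B = (SOME B. is_finite_basis V B) in \<Sum>b\<in>B. coords V B (A b) b)"

text \<open>Multilinear forms take a family \<open>x\<close> of matrices indexed by \<open>nat\<close>; the form below only reads
  \<open>x 1, \<dots>, x k\<close>.\<close>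

definition ad_form :: "nat \<Rightarrow> nat \<Rightarrow> (nat \<Rightarrow> 'a::field mat) \<Rightarrow> 'a" where
  "ad_form n k x = operator_trace (sl_vs n) (foldr (\<lambda>i. ad (x i)) [1..<Suc k])"

text \<open>\<open>D\<close> maps each element of the basis \<open>B\<close> of \<open>sl n\<close> to the corresponding element of the
  dual basis.\<close>

definition is_dual_basis :: "nat \<Rightarrow> 'a::field mat set \<Rightarrow> ('a mat \<Rightarrow> 'a mat) \<Rightarrow> bool" where
  "is_dual_basis n B D \<longleftrightarrow> (\<forall>b\<in>B. D b \<in> sl n \<and>
     (\<forall>c\<in>B. mat_trace (c * D b) = (if c = b then 1 else 0)))"

text \<open>For a two-element set \<open>P\<close>, the basis element is inserted at the smaller index and the dual one
  at the larger; by symmetry of the trace form this choice does not matter.\<close>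

definition contract ::
  "'a::field mat set \<Rightarrow> ('a mat \<Rightarrow> 'a mat) \<Rightarrow> nat set \<Rightarrow>
   ((nat \<Rightarrow> 'a mat) \<Rightarrow> 'a) \<Rightarrow> (nat \<Rightarrow> 'a mat) \<Rightarrow> 'a" where
  "contract B D P g x = (\<Sum>\<alpha>\<in>B. g (x(Min P := \<alpha>, Max P := D \<alpha>)))"

text \<open>The order in which the pairs are contracted is irrelevant when they are disjoint, see
  \<open>comp_fun_commute_on_contract\<close> below.\<close>

definition contract_all ::
  "'a::field mat set \<Rightarrow> ('a mat \<Rightarrow> 'a mat) \<Rightarrow> nat set set \<Rightarrow>
   ((nat \<Rightarrow> 'a mat) \<Rightarrow> 'a) \<Rightarrow> (nat \<Rightarrow> 'a mat) \<Rightarrow> 'a" where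
  "contract_all B D \<pi> g = Finite_Set.fold (contract B D) g \<pi>"

definition is_pairing :: "nat \<Rightarrow> nat set set \<Rightarrow> bool" where
  "is_pairing k \<pi> \<longleftrightarrow> (\<forall>P\<in>\<pi>. P \<subseteq> {1..k} \<and> card P = 2) \<and> pairwise disjnt \<pi>"

definition free_indices :: "nat \<Rightarrow> nat set set \<Rightarrow> nat set" where
  "free_indices k \<pi> = {1..k} - \<Union>\<pi>"

datatype letter = Plain nat | Transposed nat

fun letter_index :: "letter \<Rightarrow> nat" where
  "letter_index (Plain i) = i"
| "letter_index (Transposed i) = i"

fun letter_mat :: "(nat \<Rightarrow> 'a mat) \<Rightarrow> letter \<Rightarrow> 'a mat" where
  "letter_mat x (Plain i) = x i"
| "letter_mat x (Transposed i) = transpose_mat (x i)"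

definition word_mat :: "nat \<Rightarrow> (nat \<Rightarrow> 'a::field mat) \<Rightarrow> letter list \<Rightarrow> 'a mat" where
  "word_mat n x w = foldr (\<lambda>l M. letter_mat x l * M) w (1\<^sub>m n)"

text \<open>Empty words are excluded: they would contribute the trace \<open>n\<close> of the identity matrix, by
  which powers of \<open>n\<close> could be moved from the coefficients into the expressions.\<close>

definition is_trace_expr :: "nat set \<Rightarrow> letter list list \<Rightarrow> bool" where
  "is_trace_expr I T \<longleftrightarrow> (\<forall>w\<in>set T. w \<noteq> [] \<and> letter_index ` set w \<subseteq> I)"

definition eval_trace_expr :: "nat \<Rightarrow> (nat \<Rightarrow> 'a::field mat) \<Rightarrow> letter list list \<Rightarrow> 'a" where
  "eval_trace_expr n x T = (\<Prod>w\<leftarrow>T. mat_trace (word_mat n x w))"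

lemma vectorspace_sl: "vectorspace class_ring (sl_vs n :: ('a::field, 'a mat) module)"
proof -
  interpret matrix_vs n n "TYPE('a)" .
  have "VectorSpace.subspace class_ring (sl n :: 'a mat set) V"
    unfolding VectorSpace.subspace_def submodule_def
    using vectorspace_axioms module_axioms
    by (auto simp: sl_def mat_trace_def module_mat_simps sum.distrib
        simp flip: sum_distrib_left)
  from subspace_is_vs[OF this] show ?thesis .
qed

lemma comp_fun_commute_on_contract:
  assumes "is_pairing k \<pi>"
  shows "Finite_Set.comp_fun_commute_on \<pi> (contract B D)"
proof
  fix P Q assume PQ: "P \<in> \<pi>" "Q \<in> \<pi>"
  show "contract B D Q \<circ> contract B D P = contract B D P \<circ> contract B D Q"
  proof (cases "P = Q")
    case False
    with PQ assms have "P \<inter> Q = {}" "finite P" "finite Q" "P \<noteq> {}" "Q \<noteq> {}"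
      unfolding is_pairing_def pairwise_def disjnt_def
      by (metis, (metis card.infinite card.empty zero_neq_numeral)+)
    then have "{Min P, Max P} \<inter> {Min Q, Max Q} = {}"
      by (metis Int_mono Min_in Max_in empty_subsetI insert_subset subset_empty)
    then have upd: "x(Q1 := d, Q2 := e, P1 := a, P2 := b) = x(P1 := a, P2 := b, Q1 := d, Q2 := e)"
      if "P1 = Min P" "P2 = Max P" "Q1 = Min Q" "Q2 = Max Q"
      for x :: "nat \<Rightarrow> 'a mat" and a b d e P1 P2 Q1 Q2
      using that by (auto simp: fun_eq_iff)
    show ?thesis
      by (intro ext, simp add: contract_def upd, rule sum.swap)
  qed simp
qed

end

theory Submission
  imports Defs
begin

text \<open>
  Over all \<open>n\<times>n\<close> matrices, \<open>ad x\<close> is the difference of left and right multiplication by \<open>x\<close>, and the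
  contraction tensor is \<open>\<Sum> E\<^sub>i\<^sub>j \<otimes> E\<^sub>j\<^sub>i\<close>. Substituting this tensor at two places of a product of traces of
  words gives again such a product: two different words are joined into one,
  \<open>tr (E\<^sub>i\<^sub>j P) tr (E\<^sub>j\<^sub>i Q) \<mapsto> tr (P Q)\<close>, and a single word is cut into two,
  \<open>tr (E\<^sub>i\<^sub>j P E\<^sub>j\<^sub>i Q) \<mapsto> tr P tr Q\<close>. The matrix size enters only through the empty words, whose trace is
  \<open>n\<close>; hence the number of traces bounds the degree of the coefficients.

  On traceless matrices the tensor is \<open>\<Sum> E\<^sub>i\<^sub>j \<otimes> E\<^sub>j\<^sub>i - (1/n) 1 \<otimes> 1\<close> (\<open>casimir_dual_basis\<close>), whose second term
  would spoil polynomiality in \<open>n\<close>. It contributes nothing for \<open>k > 0\<close>: all forms that occur vanish as soon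
  as one argument is the identity, since \<open>ad 1 = 0\<close>, \<open>ad x 1 = 0\<close> and commutators have trace \<open>0\<close>, and
  contraction preserves this property (\<open>trace_sum_contract\<close>).

  The trace over \<open>sl n\<close> is itself a contraction: it arises from
  \<open>Tr (ad x\<^sub>1 (\<dots> (ad x\<^sub>k x\<^sub>0)) x\<^sub>k\<^sub>+\<^sub>1)\<close>, a signed sum of traces of one word, by contracting \<open>0\<close> with
  \<open>k + 1\<close> (\<open>ad_form_trace_sum\<close>). So after all \<open>q\<close> pairs there have been \<open>q + 1\<close> contractions, each adding at
  most one trace to the initial one, and every coefficient has degree at most \<open>q + 2 \<le> k + 2\<close>. For \<open>k = 0\<close>
  the correction term does not vanish and accounts for the \<open>-1\<close> in \<open>n\<^sup>2 - 1\<close>.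
\<close>

section \<open>Traces of matrix products\<close>

lemma mat_trace_mult:
  assumes "A \<in> carrier_mat n m" "B \<in> carrier_mat m n"
  shows "mat_trace (A * B) = (\<Sum>i<n. \<Sum>j<m. A $$ (i, j) * B $$ (j, i))"
  using assms by (auto simp: mat_trace_def scalar_prod_def atLeast0LessThan intro!: sum.cong)

lemma mat_trace_mult_comm:
  fixes A B :: "'a::field mat"
  assumes "A \<in> carrier_mat n n" "B \<in> carrier_mat n n"
  shows "mat_trace (A * B) = mat_trace (B * A)"
  by (simp add: mat_trace_mult[OF assms] mat_trace_mult[OF assms(2,1)] mult.commute)
    (rule sum.swap)

lemma mat_trace_diff:
  fixes A B :: "'a::field mat"
  assumes "A \<in> carrier_mat n n" "B \<in> carrier_mat n n"
  shows "mat_trace (A - B) = mat_trace A - mat_trace B"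
  using assms by (auto simp: mat_trace_def sum_subtractf)

lemma mat_trace_one: "mat_trace (1\<^sub>m n :: 'a::field mat) = of_nat n"
  by (simp add: mat_trace_def)

lemma mat_trace_zero: "mat_trace (0\<^sub>m n n :: 'a::field mat) = 0"
  by (simp add: mat_trace_def)

section \<open>The Casimir tensor\<close>

text \<open>
  In tensor notation the condition is \<open>\<Sum> b \<otimes> D b = \<Sum> E\<^sub>i\<^sub>j \<otimes> E\<^sub>j\<^sub>i - (1/n) 1 \<otimes> 1\<close>. It captures all that
  contraction uses of a pair of dual bases, and so also covers the trace of an operator, for which the
  second member of the pair arises from coordinate functions.
\<close>

definition casimir :: "nat \<Rightarrow> 'a::field mat set \<Rightarrow> ('a mat \<Rightarrow> 'a mat) \<Rightarrow> bool" where
  "casimir n B D \<longleftrightarrow> finite B \<and> (\<forall>b\<in>B. b \<in> carrier_mat n n \<and> D b \<in> carrier_mat n n) \<and>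
     (\<forall>i<n. \<forall>j<n. \<forall>k<n. \<forall>l<n. (\<Sum>b\<in>B. b $$ (i, j) * D b $$ (k, l)) =
        of_bool (i = l \<and> j = k) - of_bool (i = j \<and> k = l) / of_nat n)"

lemma casimir_sum:
  assumes "casimir n B D" "i < n" "j < n" "k < n" "l < n"
  shows "(\<Sum>b\<in>B. b $$ (i, j) * D b $$ (k, l)) =
        of_bool (i = l \<and> j = k) - of_bool (i = j \<and> k = l) / of_nat n"
  using assms unfolding casimir_def by blast

lemma casimir_carrier:
  assumes "casimir n B D" "b \<in> B"
  shows "b \<in> carrier_mat n n" "D b \<in> carrier_mat n n"
  using assms unfolding casimir_def by auto

text \<open>
  Every contraction reduces to this sum over four matrix indices: the swap part of the Casimir tensor
  identifies them crosswise, the correction part identifies the two indices of each factor.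
\<close>

lemma casimir_entry_sum:
  fixes t :: "nat \<Rightarrow> nat \<Rightarrow> nat \<Rightarrow> nat \<Rightarrow> 'a::field"
  shows "(\<Sum>i<n. \<Sum>j<n. \<Sum>k<n. \<Sum>l<n.
      (of_bool (i = l \<and> j = k) - of_bool (i = j \<and> k = l) / of_nat n) * t i j k l) =
    (\<Sum>i<n. \<Sum>j<n. t i j j i) - (\<Sum>i<n. \<Sum>k<n. t i i k k) / of_nat n"
proof -
  have flip: "(\<Sum>k<n. \<Sum>l<n. of_bool (i = l \<and> j = k) * t i j k l) = t i j j i"
    if "i < n" "j < n" for i j
  proof -
    have "(\<Sum>k<n. \<Sum>l<n. of_bool (i = l \<and> j = k) * t i j k l) =
        (\<Sum>k<n. \<Sum>l<n. if l = i then (if k = j then t i j k l else 0) else 0)"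
      by (intro sum.cong refl) auto
    then show ?thesis using that by simp
  qed
  have diag: "(\<Sum>j<n. \<Sum>k<n. \<Sum>l<n. of_bool (i = j \<and> k = l) * t i j k l) = (\<Sum>k<n. t i i k k)"
    if "i < n" for i
  proof -
    have "(\<Sum>j<n. \<Sum>k<n. \<Sum>l<n. of_bool (i = j \<and> k = l) * t i j k l) =
        (\<Sum>j<n. \<Sum>k<n. \<Sum>l<n. if l = k then (if j = i then t i j k l else 0) else 0)"
      by (intro sum.cong refl) auto
    also have "\<dots> = (\<Sum>j<n. if j = i then (\<Sum>k<n. t i j k k) else 0)"
      by (intro sum.cong refl) auto
    finally show ?thesis using that by simp
  qed
  show ?thesis
    by (simp add: left_diff_distrib sum_subtractf flip diag del: sum_mult_of_bool_eq sum_of_bool_mult_eq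
        flip: sum_divide_distrib)
qed

text \<open>
  The swap part of the tensor glues two traces into one. Up to the factor \<open>1/n\<close>, the correction term is
  the value of the summand with the identity in place of both \<open>b\<close> and \<open>D b\<close>; this is the form in which it
  cancels later.
\<close>

lemma casimir_join:
  fixes P Q :: "'a::field mat"
  assumes c: "casimir n B D" and P: "P \<in> carrier_mat n n" and Q: "Q \<in> carrier_mat n n"
  shows "(\<Sum>b\<in>B. mat_trace (b * P) * mat_trace (D b * Q)) =
    mat_trace (P * Q) - mat_trace P * mat_trace Q / of_nat n"
proof -
  have "(\<Sum>b\<in>B. mat_trace (b * P) * mat_trace (D b * Q)) =
      (\<Sum>b\<in>B. \<Sum>i<n. \<Sum>j<n. \<Sum>k<n. \<Sum>l<n. (b $$ (i, j) * D b $$ (k, l)) * (P $$ (j, i) * Q $$ (l, k)))"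
    using casimir_carrier[OF c] P Q
    by (intro sum.cong refl)
      (simp add: mat_trace_mult[of _ n n] sum_distrib_right, simp add: sum_distrib_left mult_ac)
  also have "\<dots> = (\<Sum>i<n. \<Sum>j<n. \<Sum>k<n. \<Sum>l<n.
      (\<Sum>b\<in>B. b $$ (i, j) * D b $$ (k, l)) * (P $$ (j, i) * Q $$ (l, k)))"
    by (subst sum.swap, rule sum.cong[OF refl], subst sum.swap, rule sum.cong[OF refl],
        subst sum.swap, rule sum.cong[OF refl], subst sum.swap, rule sum.cong[OF refl])
      (simp add: sum_distrib_right)
  also have "\<dots> = (\<Sum>i<n. \<Sum>j<n. \<Sum>k<n. \<Sum>l<n.
      (of_bool (i = l \<and> j = k) - of_bool (i = j \<and> k = l) / of_nat n) * (P $$ (j, i) * Q $$ (l, k)))"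
    by (intro sum.cong refl) (simp add: casimir_sum[OF c])
  also have "\<dots> = (\<Sum>i<n. \<Sum>j<n. P $$ (j, i) * Q $$ (i, j)) -
      (\<Sum>i<n. \<Sum>k<n. P $$ (i, i) * Q $$ (k, k)) / of_nat n"
    by (rule casimir_entry_sum)
  also have "\<dots> = mat_trace (P * Q) - mat_trace P * mat_trace Q / of_nat n"
    using P Q by (simp add: mat_trace_mult_comm[OF P Q] mat_trace_mult[of Q n n P] mult.commute)
      (simp add: mat_trace_def sum_product)
  finally show ?thesis .
qed

text \<open>
  Within one trace, the swap part of the tensor separates the two arcs between the contracted places.
\<close>

lemma casimir_cut:
  fixes P Q :: "'a::field mat"
  assumes c: "casimir n B D" and P: "P \<in> carrier_mat n n" and Q: "Q \<in> carrier_mat n n"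
  shows "(\<Sum>b\<in>B. mat_trace (b * (P * (D b * Q)))) =
    mat_trace P * mat_trace Q - mat_trace (P * Q) / of_nat n"
proof -
  have "(\<Sum>b\<in>B. mat_trace (b * (P * (D b * Q)))) =
      (\<Sum>b\<in>B. \<Sum>i<n. \<Sum>j<n. \<Sum>k<n. \<Sum>l<n. (b $$ (i, j) * D b $$ (k, l)) * (P $$ (j, k) * Q $$ (l, i)))"
  proof (rule sum.cong[OF refl])
    fix b assume b: "b \<in> B"
    note bD = casimir_carrier[OF c b]
    have "(P * (D b * Q)) $$ (j, i) = (\<Sum>k<n. \<Sum>l<n. P $$ (j, k) * (D b $$ (k, l) * Q $$ (l, i)))"
      if "i < n" "j < n" for i j
      using that P Q bD by (simp add: scalar_prod_def atLeast0LessThan sum_distrib_left)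
    moreover have "P * (D b * Q) \<in> carrier_mat n n" using P Q bD by simp
    ultimately show "mat_trace (b * (P * (D b * Q))) = (\<Sum>i<n. \<Sum>j<n. \<Sum>k<n. \<Sum>l<n.
        (b $$ (i, j) * D b $$ (k, l)) * (P $$ (j, k) * Q $$ (l, i)))"
      using bD by (simp add: mat_trace_mult[of _ n n] sum_distrib_left mult_ac)
  qed
  also have "\<dots> = (\<Sum>i<n. \<Sum>j<n. \<Sum>k<n. \<Sum>l<n.
      (\<Sum>b\<in>B. b $$ (i, j) * D b $$ (k, l)) * (P $$ (j, k) * Q $$ (l, i)))"
    by (subst sum.swap, rule sum.cong[OF refl], subst sum.swap, rule sum.cong[OF refl],
        subst sum.swap, rule sum.cong[OF refl], subst sum.swap, rule sum.cong[OF refl])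
      (simp add: sum_distrib_right)
  also have "\<dots> = (\<Sum>i<n. \<Sum>j<n. \<Sum>k<n. \<Sum>l<n.
      (of_bool (i = l \<and> j = k) - of_bool (i = j \<and> k = l) / of_nat n) * (P $$ (j, k) * Q $$ (l, i)))"
    by (intro sum.cong refl) (simp add: casimir_sum[OF c])
  also have "\<dots> = (\<Sum>i<n. \<Sum>j<n. P $$ (j, j) * Q $$ (i, i)) -
      (\<Sum>i<n. \<Sum>k<n. P $$ (i, k) * Q $$ (k, i)) / of_nat n"
    by (rule casimir_entry_sum)
  also have "\<dots> = mat_trace P * mat_trace Q - mat_trace (P * Q) / of_nat n"
    using P Q by (simp add: mat_trace_mult[of P n n Q])
      (simp add: mat_trace_def sum_product mult.commute, rule sum.swap)
  finally show ?thesis .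
qed

section \<open>Bases of the traceless matrices\<close>

text \<open>
  Linear combinations in \<open>sl n\<close> are taken in an abstract module; entrywise they are ordinary sums.
\<close>

lemma finsum_sl_index:
  assumes "finite B" "f \<in> B \<rightarrow> sl n" "i < n" "j < n"
  shows "finsum (sl_vs n :: ('a::field, 'a mat) module) f B $$ (i, j) = (\<Sum>b\<in>B. f b $$ (i, j))"
proof -
  interpret vectorspace class_ring "sl_vs n :: ('a, 'a mat) module" by (rule vectorspace_sl)
  have "finsum (sl_vs n) f B \<in> sl n \<and> finsum (sl_vs n) f B $$ (i, j) = (\<Sum>b\<in>B. f b $$ (i, j))"
    using assms(1,2)
  proof (induction B rule: finite_induct)
    case empty
    have "finsum (sl_vs n) f {} \<in> carrier (sl_vs n :: ('a, 'a mat) module)"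
      by (rule M.finsum_closed) simp
    then show ?case using assms(3,4) by (simp add: module_mat_simps)
  next
    case (insert b B)
    then have fb: "f b \<in> carrier (sl_vs n)" "f \<in> B \<rightarrow> carrier (sl_vs n)"
      and IH: "finsum (sl_vs n) f B \<in> sl n" "finsum (sl_vs n) f B $$ (i, j) = (\<Sum>b\<in>B. f b $$ (i, j))"
      by auto
    have eq: "finsum (sl_vs n) f (insert b B) = f b + finsum (sl_vs n) f B"
      using M.finsum_insert[OF insert(1,2) fb(2,1)] by (simp add: module_mat_simps)
    have "finsum (sl_vs n) f (insert b B) \<in> carrier (sl_vs n)"
      by (rule M.finsum_closed) (use fb in auto)
    then show ?case using IH insert(1,2) fb assms(3,4) eq
      by (auto simp: sl_def)
  qed
  then show ?thesis by simp
qed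

lemma sl_basis_subset:
  assumes "is_finite_basis (sl_vs n) B"
  shows "B \<subseteq> sl n"
  using assms vectorspace.basis_def[OF vectorspace_sl] by (auto simp: is_finite_basis_def)

lemma lincomb_sl_index:
  assumes "finite B" "B \<subseteq> sl n" "i < n" "j < n"
  shows "LinearCombinations.module.lincomb (sl_vs n :: ('a::field, 'a mat) module) c B $$ (i, j) =
    (\<Sum>b\<in>B. c b * b $$ (i, j))"
proof -
  interpret vectorspace class_ring "sl_vs n :: ('a, 'a mat) module" by (rule vectorspace_sl)
  have smult: "c b \<odot>\<^bsub>sl_vs n\<^esub> b \<in> sl n" if "b \<in> B" for b
    using smult_closed[of "c b" b] that assms(2) by (auto simp: class_ring_simps)
  have "lincomb c B $$ (i, j) = (\<Sum>b\<in>B. (c b \<odot>\<^bsub>sl_vs n\<^esub> b) $$ (i, j))"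
    unfolding lincomb_def by (rule finsum_sl_index) (use assms smult in auto)
  also have "\<dots> = (\<Sum>b\<in>B. c b * b $$ (i, j))"
    using assms by (intro sum.cong) (auto simp: module_mat_simps sl_def)
  finally show ?thesis .
qed

lemma
  assumes B: "is_finite_basis (sl_vs n) B" and X: "X \<in> sl n" and ij: "i < n" "j < n"
  shows coords_sl_index: "X $$ (i, j) = (\<Sum>b\<in>B. coords (sl_vs n) B X b * b $$ (i, j))"
    and coords_sl_unique: "\<And>c b. (\<And>i j. i < n \<Longrightarrow> j < n \<Longrightarrow> X $$ (i, j) = (\<Sum>b\<in>B. c b * b $$ (i, j)))
      \<Longrightarrow> b \<in> B \<Longrightarrow> coords (sl_vs n) B X b = c b"
proof -
  interpret vectorspace class_ring "sl_vs n :: ('a, 'a mat) module" by (rule vectorspace_sl)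
  have fin: "finite B" and bas: "basis B" using B by (auto simp: is_finite_basis_def)
  note sub = sl_basis_subset[OF B]
  have ex1: "\<exists>!c. c \<in> B \<rightarrow>\<^sub>E UNIV \<and> lincomb c B = X"
    using basis_criterion[OF fin] bas sub X by (simp add: class_ring_simps)
  have the: "coords (sl_vs n) B X = c" if "c \<in> B \<rightarrow>\<^sub>E UNIV" "lincomb c B = X" for c
    unfolding coords_def using ex1 that by (intro the1_equality) auto
  have eq: "lincomb (coords (sl_vs n) B X) B = X"
    unfolding coords_def using theI'[OF ex1] by blast
  show "X $$ (i, j) = (\<Sum>b\<in>B. coords (sl_vs n) B X b * b $$ (i, j))"
    using lincomb_sl_index[OF fin sub ij, of "coords (sl_vs n) B X"] unfolding eq .
  fix c b
  assume c: "\<And>i j. i < n \<Longrightarrow> j < n \<Longrightarrow> X $$ (i, j) = (\<Sum>b\<in>B. c b * b $$ (i, j))" and b: "b \<in> B"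
  have Xc: "X \<in> carrier_mat n n" using X by (simp add: sl_def)
  have "lincomb (restrict c B) B \<in> carrier (sl_vs n)"
    by (rule lincomb_closed) (use sub in \<open>auto simp: class_ring_simps\<close>)
  then have "lincomb (restrict c B) B \<in> carrier_mat n n" by (simp add: sl_def)
  then have "lincomb (restrict c B) B = X"
    using Xc by (intro eq_matI) (auto simp: c lincomb_sl_index[OF fin sub])
  from the[OF _ this] have "coords (sl_vs n) B X = restrict c B" by auto
  then show "coords (sl_vs n) B X b = c b" using b by simp
qed

text \<open>
  The projection of the matrix unit \<open>E\<^sub>l\<^sub>k\<close> to \<open>sl n\<close>.
\<close>

definition traceless_unit :: "nat \<Rightarrow> nat \<Rightarrow> nat \<Rightarrow> 'a::field mat" where
  "traceless_unit n l k =
     mat n n (\<lambda>(i, j). of_bool (i = l \<and> j = k) - of_bool (i = j \<and> k = l) / of_nat n)"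

lemma traceless_unit_carrier [simp]: "traceless_unit n l k \<in> carrier_mat n n"
  by (simp add: traceless_unit_def)

lemma traceless_unit_index:
  assumes "i < n" "j < n"
  shows "traceless_unit n l k $$ (i, j) =
    of_bool (i = l \<and> j = k) - of_bool (i = j \<and> k = l) / of_nat n"
  using assms by (simp add: traceless_unit_def)

text \<open>
  Pairing with a projected matrix unit reads off an entry, which turns statements about the trace form
  into statements about entries.
\<close>

lemma mat_trace_traceless_unit_mult:
  assumes "Y \<in> carrier_mat n n" "l < n" "k < n"
  shows "mat_trace (traceless_unit n l k * Y) = Y $$ (k, l) - of_bool (k = l) * mat_trace Y / of_nat n"
proof -
  have "(\<Sum>i<n. \<Sum>j<n. of_bool (i = l \<and> j = k) * Y $$ (j, i)) =
      (\<Sum>i<n. \<Sum>j<n. if j = k then (if i = l then Y $$ (j, i) else 0) else 0)"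
    by (intro sum.cong refl) auto
  then have 1: "(\<Sum>i<n. \<Sum>j<n. of_bool (i = l \<and> j = k) * Y $$ (j, i)) = Y $$ (k, l)"
    using assms by simp
  have "(\<Sum>i<n. \<Sum>j<n. of_bool (i = j \<and> k = l) * Y $$ (j, i)) =
      (\<Sum>i<n. \<Sum>j<n. if j = i then of_bool (k = l) * Y $$ (j, i) else 0)"
    by (intro sum.cong refl) auto
  also have "\<dots> = of_bool (k = l) * mat_trace Y"
    using assms by (simp add: mat_trace_def sum_distrib_left)
  finally have 2: "(\<Sum>i<n. \<Sum>j<n. of_bool (i = j \<and> k = l) * Y $$ (j, i)) = of_bool (k = l) * mat_trace Y" .
  have "mat_trace (traceless_unit n l k * Y) = (\<Sum>i<n. \<Sum>j<n.
      (of_bool (i = l \<and> j = k) - of_bool (i = j \<and> k = l) / of_nat n) * Y $$ (j, i))"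
    unfolding mat_trace_mult[OF traceless_unit_carrier assms(1)]
    by (intro sum.cong refl) (simp only: lessThan_iff traceless_unit_index)
  also have "\<dots> = (\<Sum>i<n. \<Sum>j<n. of_bool (i = l \<and> j = k) * Y $$ (j, i)) -
      (\<Sum>i<n. \<Sum>j<n. of_bool (i = j \<and> k = l) * Y $$ (j, i)) / of_nat n"
    by (simp only: left_diff_distrib sum_subtractf sum_divide_distrib times_divide_eq_left)
  finally show ?thesis using 1 2 by simp
qed

lemma traceless_unit_sl:
  assumes "n > 0" "l < n" "k < n"
  shows "(traceless_unit n l k :: 'a::field_char_0 mat) \<in> sl n"
proof -
  have "mat_trace (traceless_unit n l k :: 'a mat) = mat_trace (traceless_unit n l k * (1\<^sub>m n :: 'a mat))"
    by (simp add: traceless_unit_def)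
  also have "\<dots> = 0"
    by (subst mat_trace_traceless_unit_mult) (use assms in \<open>auto simp: mat_trace_one\<close>)
  finally show ?thesis by (simp add: sl_def traceless_unit_def)
qed

text \<open>
  Expanding \<open>E\<^sub>l\<^sub>k - \<delta>\<^sub>l\<^sub>k/n\<close> in the basis \<open>B\<close> and reading off the entry \<open>(i, j)\<close> is precisely the Casimir
  identity, provided that the entry \<open>(k, l)\<close> of \<open>D b\<close> is the coefficient of \<open>b\<close>.
\<close>

lemma casimir_if_coords:
  fixes B :: "'a::field_char_0 mat set"
  assumes n: "n > 0" and B: "is_finite_basis (sl_vs n) B"
    and D: "\<And>b. b \<in> B \<Longrightarrow> D b \<in> carrier_mat n n"
    and c: "\<And>b k l. b \<in> B \<Longrightarrow> k < n \<Longrightarrow> l < n \<Longrightarrow>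
      D b $$ (k, l) = coords (sl_vs n) B (traceless_unit n l k) b"
  shows "casimir n B D"
  unfolding casimir_def
proof (intro conjI ballI allI impI)
  show "finite B" using B by (simp add: is_finite_basis_def)
  fix b assume "b \<in> B"
  then show "b \<in> carrier_mat n n" "D b \<in> carrier_mat n n"
    using sl_basis_subset[OF B] D by (auto simp: sl_def)
next
  fix i j k l assume ijkl: "i < n" "j < n" "k < n" "l < n"
  have "(\<Sum>b\<in>B. b $$ (i, j) * D b $$ (k, l)) =
      (\<Sum>b\<in>B. coords (sl_vs n) B (traceless_unit n l k) b * b $$ (i, j))"
    using c ijkl by (intro sum.cong) (auto simp: mult.commute)
  also have "\<dots> = traceless_unit n l k $$ (i, j)"
    using coords_sl_index[OF B traceless_unit_sl[OF n ijkl(4,3)] ijkl(1,2)] by simp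
  finally show "(\<Sum>b\<in>B. b $$ (i, j) * D b $$ (k, l)) =
      of_bool (i = l \<and> j = k) - of_bool (i = j \<and> k = l) / of_nat n"
    using ijkl by (simp add: traceless_unit_def)
qed

text \<open>
  Pairing the expansion of a projected matrix unit with \<open>D b\<close> isolates the coefficient of \<open>b\<close>, and the
  same pairing is an entry of \<open>D b\<close>.
\<close>

lemma casimir_dual_basis:
  fixes B :: "'a::field_char_0 mat set"
  assumes n: "n > 0" and B: "is_finite_basis (sl_vs n) B" and D: "is_dual_basis n B D"
  shows "casimir n B D"
proof (rule casimir_if_coords[OF n B])
  fix b assume b: "b \<in> B"
  then have Db: "D b \<in> sl n" using D by (auto simp: is_dual_basis_def)
  then show Dc: "D b \<in> carrier_mat n n" by (simp add: sl_def)
  fix k l assume kl: "k < n" "l < n"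
  let ?E = "traceless_unit n l k :: 'a mat"
  note fin = B[unfolded is_finite_basis_def, THEN conjunct1]
  have bc: "c \<in> carrier_mat n n" if "c \<in> B" for c
    using that sl_basis_subset[OF B] by (auto simp: sl_def)
  have "D b $$ (k, l) = mat_trace (?E * D b)"
    using mat_trace_traceless_unit_mult[OF Dc kl(2,1)] Db by (simp add: sl_def)
  also have "\<dots> = (\<Sum>i<n. \<Sum>j<n. (\<Sum>c\<in>B. coords (sl_vs n) B ?E c * c $$ (i, j)) * D b $$ (j, i))"
    unfolding mat_trace_mult[OF traceless_unit_carrier Dc]
    by (intro sum.cong refl)
      (simp only: lessThan_iff flip: coords_sl_index[OF B traceless_unit_sl[OF n kl(2,1)]])
  also have "\<dots> = (\<Sum>i<n. \<Sum>c\<in>B. \<Sum>j<n. coords (sl_vs n) B ?E c * c $$ (i, j) * D b $$ (j, i))"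
    unfolding sum_distrib_right by (rule sum.cong[OF refl], rule sum.swap)
  also have "\<dots> = (\<Sum>c\<in>B. \<Sum>i<n. \<Sum>j<n. coords (sl_vs n) B ?E c * c $$ (i, j) * D b $$ (j, i))"
    by (rule sum.swap)
  also have "\<dots> = (\<Sum>c\<in>B. coords (sl_vs n) B ?E c * mat_trace (c * D b))"
    using bc Dc by (intro sum.cong refl)
      (simp add: mat_trace_mult[of _ n n] sum_distrib_left mult.assoc)
  also have "\<dots> = (\<Sum>c\<in>B. if c = b then coords (sl_vs n) B ?E c else 0)"
    using D b by (intro sum.cong refl) (auto simp: is_dual_basis_def)
  also have "\<dots> = coords (sl_vs n) B ?E b" using fin b by simp
  finally show "D b $$ (k, l) = coords (sl_vs n) B ?E b" .
qed

text \<open>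
  A coordinate function is a linear functional on \<open>sl n\<close>, hence the trace against some matrix \<open>D' b\<close>.
  So the trace of an operator is a contraction as well, though with respect to the basis chosen in the
  definition of \<open>operator_trace\<close>. This difference is harmless because the Casimir tensor determines every
  contraction.
\<close>

lemma operator_trace_sl_casimir:
  fixes B :: "'a::field_char_0 mat set"
  assumes n: "n > 0" and B: "is_finite_basis (sl_vs n) B"
  obtains B' D' where "casimir n B' (D' :: 'a mat \<Rightarrow> 'a mat)"
    "\<And>A. A \<in> B' \<rightarrow> sl n \<Longrightarrow> operator_trace (sl_vs n) A = (\<Sum>b\<in>B'. mat_trace (A b * D' b))"
    "B' \<subseteq> sl n"
proof -
  define B' :: "'a mat set" where "B' = (SOME B. is_finite_basis (sl_vs n) B)"
  have B': "is_finite_basis (sl_vs n) B'" unfolding B'_def using B by (rule someI)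
  \<comment> \<open>The trace of \<open>E\<^sub>l\<^sub>k\<close> against a matrix is its entry \<open>(k, l)\<close>, so this entry must be the coefficient
     of \<open>b\<close> in the projection of \<open>E\<^sub>l\<^sub>k\<close>.\<close>
  define D' where "D' b = mat n n (\<lambda>(k, l). coords (sl_vs n) B' (traceless_unit n l k) b)" for b
  have Dc: "D' b \<in> carrier_mat n n" for b by (simp add: D'_def)
  have cas: "casimir n B' D'"
    by (rule casimir_if_coords[OF n B' Dc]) (simp add: D'_def)
  have "coords (sl_vs n) B' X b = mat_trace (X * D' b)" if X: "X \<in> sl n" and b: "b \<in> B'" for X b
  proof (rule coords_sl_unique[OF B' X n n _ b])
    fix i j assume ij: "i < n" "j < n"
    have Xc: "X \<in> carrier_mat n n" and trX: "mat_trace X = 0" using X by (auto simp: sl_def)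
    have "(\<Sum>b\<in>B'. mat_trace (X * D' b) * b $$ (i, j)) =
        (\<Sum>b\<in>B'. \<Sum>k<n. \<Sum>l<n. (b $$ (i, j) * D' b $$ (l, k)) * X $$ (k, l))"
      using Xc Dc by (simp add: mat_trace_mult[of _ n n] sum_distrib_left sum_distrib_right mult_ac)
    also have "\<dots> = (\<Sum>k<n. \<Sum>l<n. (\<Sum>b\<in>B'. b $$ (i, j) * D' b $$ (l, k)) * X $$ (k, l))"
      by (subst sum.swap, rule sum.cong[OF refl], subst sum.swap) (simp add: sum_distrib_right)
    also have "\<dots> = (\<Sum>k<n. \<Sum>l<n. traceless_unit n j i $$ (l, k) * X $$ (k, l))"
    proof (intro sum.cong refl arg_cong2[where f = "(*)"])
      fix k l assume "k \<in> {..<n}" "l \<in> {..<n}"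
      then have "k < n" "l < n" by auto
      moreover have "(i = k \<and> j = l) = (l = j \<and> k = i)" "(i = j \<and> l = k) = (l = k \<and> i = j)"
        by auto
      ultimately show "(\<Sum>b\<in>B'. b $$ (i, j) * D' b $$ (l, k)) = traceless_unit n j i $$ (l, k)"
        by (simp only: casimir_sum[OF cas ij] traceless_unit_index)
    qed
    also have "\<dots> = mat_trace (X * traceless_unit n j i)"
      by (simp only: mat_trace_mult[OF Xc traceless_unit_carrier] mult.commute)
    also have "\<dots> = mat_trace (traceless_unit n j i * X)"
      by (rule mat_trace_mult_comm[OF Xc traceless_unit_carrier])
    also have "\<dots> = X $$ (i, j)"
      using mat_trace_traceless_unit_mult[OF Xc ij(2,1)] trX by simp
    finally show "X $$ (i, j) = (\<Sum>b\<in>B'. mat_trace (X * D' b) * b $$ (i, j))" ..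
  qed
  then have "operator_trace (sl_vs n) A = (\<Sum>b\<in>B'. mat_trace (A b * D' b))" if "A \<in> B' \<rightarrow> sl n" for A
    unfolding operator_trace_def Let_def B'_def[symmetric] using that by (intro sum.cong) auto
  from that[OF cas this sl_basis_subset[OF B']] show ?thesis by blast
qed

section \<open>Trace monomials and their contraction\<close>

definition word :: "nat \<Rightarrow> (nat \<Rightarrow> 'a::field mat) \<Rightarrow> nat list \<Rightarrow> 'a mat" where
  "word n x w = foldr (\<lambda>i M. x i * M) w (1\<^sub>m n)"

definition monomial :: "nat \<Rightarrow> (nat \<Rightarrow> 'a::field mat) \<Rightarrow> nat list list \<Rightarrow> 'a" where
  "monomial n x T = (\<Prod>w\<leftarrow>T. mat_trace (word n x w))"

lemma word_simps [simp]:
  "word n x [] = 1\<^sub>m n"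
  "word n x (i # w) = x i * word n x w"
  by (simp_all add: word_def)

lemma monomial_simps [simp]:
  "monomial n x [] = 1"
  "monomial n x (w # T) = mat_trace (word n x w) * monomial n x T"
  "monomial n x (T @ T') = monomial n x T * monomial n x T'"
  by (simp_all add: monomial_def)

lemma word_carrier:
  assumes "\<And>i. i \<in> set w \<Longrightarrow> x i \<in> carrier_mat n n"
  shows "word n x w \<in> carrier_mat n n"
  using assms by (induction w) (auto intro!: mult_carrier_mat[of _ n n])

lemma word_append:
  assumes "\<And>i. i \<in> set u \<union> set v \<Longrightarrow> x i \<in> carrier_mat n n"
  shows "word n x (u @ v) = word n x u * word n x v"
  using assms
proof (induction u)
  case Nil
  then show ?case using word_carrier[of v x n] by simp
next
  case (Cons i u)
  then show ?case using word_carrier[of u x n] word_carrier[of v x n]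
    by (simp add: assoc_mult_mat[of _ n n _ n _ n])
qed

lemma word_cong:
  assumes "\<And>i. i \<in> set w \<Longrightarrow> x i = y i"
  shows "word n x w = word n y w"
  using assms by (induction w) auto

lemma monomial_cong:
  assumes "\<And>i. i \<in> set (concat T) \<Longrightarrow> x i = y i"
  shows "monomial n x T = monomial n y T"
  using assms by (induction T) (auto intro!: arg_cong2[where f = "(*)"] arg_cong[where f = mat_trace] word_cong)

text \<open>
  By cyclicity of the trace, the word containing \<open>a\<close> can be rotated to start with \<open>a\<close>.
\<close>

lemma monomial_isolate:
  assumes "distinct (concat T)" "a \<in> set (concat T)"
  obtains w R where "distinct (a # w @ concat R)" "set (a # w @ concat R) = set (concat T)"
    "length T = Suc (length R)"
    "\<And>n (x :: nat \<Rightarrow> 'a::field mat). (\<And>i. i \<in> set (concat T) \<Longrightarrow> x i \<in> carrier_mat n n) \<Longrightarrow>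
      monomial n x T = mat_trace (x a * word n x w) * monomial n x R"
proof -
  obtain v where "v \<in> set T" "a \<in> set v" using assms by auto
  then obtain T1 T2 u1 u2 where T: "T = T1 @ (u1 @ a # u2) # T2" by (metis split_list)
  show thesis
  proof (rule that[of "u2 @ u1" "T1 @ T2"])
    fix n and x :: "nat \<Rightarrow> 'a mat"
    assume x: "\<And>i. i \<in> set (concat T) \<Longrightarrow> x i \<in> carrier_mat n n"
    have x': "\<And>i. i \<in> set u1 \<union> set (a # u2) \<Longrightarrow> x i \<in> carrier_mat n n" using T x by auto
    have c: "word n x u1 \<in> carrier_mat n n" "word n x (a # u2) \<in> carrier_mat n n"
      using word_carrier[of u1 x n, OF x'] word_carrier[of "a # u2" x n, OF x'] by auto
    have "mat_trace (word n x (u1 @ a # u2)) = mat_trace (word n x u1 * word n x (a # u2))"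
      using x' by (subst word_append) auto
    also have "\<dots> = mat_trace (word n x (a # u2) * word n x u1)"
      by (rule mat_trace_mult_comm[OF c])
    also have "\<dots> = mat_trace (word n x ((a # u2) @ u1))"
      using x' by (subst word_append) auto
    finally show "monomial n x T = mat_trace (x a * word n x (u2 @ u1)) * monomial n x (T1 @ T2)"
      by (simp add: T)
  qed (use assms T in auto)
qed

text \<open>
  If \<open>a\<close> and \<open>b\<close> lie in the same word, that word is cut in two; otherwise their words are joined. The new
  monomial \<open>T'\<close> is chosen before the matrix size, which is what makes the coefficients uniform in \<open>n\<close>. The
  correction is kept as the value of the old monomial at the identity: for a single monomial it
  usually does not vanish, and only in linear combinations can it disappear.
\<close>

lemma monomial_contract:
  assumes T: "distinct (concat T)" and a: "a \<in> set (concat T)" and b: "b \<in> set (concat T)"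
    and ab: "a \<noteq> b"
  obtains T' where "distinct (concat T')" "set (concat T') = set (concat T) - {a, b}"
    "length T' \<le> Suc (length T)"
    "\<And>n B D (x :: nat \<Rightarrow> 'a::field mat). casimir n B D \<Longrightarrow>
      (\<And>i. i \<in> set (concat T) - {a, b} \<Longrightarrow> x i \<in> carrier_mat n n) \<Longrightarrow>
      (\<Sum>\<beta>\<in>B. monomial n (x(a := \<beta>, b := D \<beta>)) T) =
        monomial n x T' - monomial n (x(a := 1\<^sub>m n, b := 1\<^sub>m n)) T / of_nat n"
proof -
  obtain w R where wR: "distinct (a # w @ concat R)" "set (a # w @ concat R) = set (concat T)"
    "length T = Suc (length R)"
    and ev: "\<And>n (x :: nat \<Rightarrow> 'a mat). (\<And>i. i \<in> set (concat T) \<Longrightarrow> x i \<in> carrier_mat n n) \<Longrightarrow>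
      monomial n x T = mat_trace (x a * word n x w) * monomial n x R"
    by (rule monomial_isolate[OF T a, where ?'a = 'a]) blast
  show thesis
  proof (cases "b \<in> set w")
    case True
    then obtain p q where w: "w = p @ b # q" by (metis split_list)
    show thesis
    proof (rule that[of "p # q # R"])
      show "distinct (concat (p # q # R))" "length (p # q # R) \<le> Suc (length T)"
        using wR w by auto
      show "set (concat (p # q # R)) = set (concat T) - {a, b}"
        using wR(1) unfolding wR(2)[symmetric] w by auto
      fix n B and D :: "'a mat \<Rightarrow> 'a mat" and x :: "nat \<Rightarrow> 'a mat"
      assume cas: "casimir n B D"
        and x: "\<And>i. i \<in> set (concat T) - {a, b} \<Longrightarrow> x i \<in> carrier_mat n n"
      have mem: "i \<in> set (concat T) - {a, b}" if "i \<in> set p \<union> set q" for i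
        using that wR(1) unfolding wR(2)[symmetric] w by auto
      note P = word_carrier[of p x n, OF x, OF mem, OF UnI1]
        and Q = word_carrier[of q x n, OF x, OF mem, OF UnI2]
      have key: "monomial n (x(a := \<beta>, b := \<gamma>)) T =
          mat_trace (\<beta> * (word n x p * (\<gamma> * word n x q))) * monomial n x R"
        if "\<beta> \<in> carrier_mat n n" "\<gamma> \<in> carrier_mat n n" for \<beta> \<gamma>
      proof -
        let ?y = "x(a := \<beta>, b := \<gamma>)"
        have y: "?y i \<in> carrier_mat n n" if "i \<in> set (concat T)" for i
          using that x[of i] \<open>\<beta> \<in> _\<close> \<open>\<gamma> \<in> _\<close> by auto
        have pq: "word n ?y p = word n x p" "word n ?y q = word n x q"
          and R: "monomial n ?y R = monomial n x R"
          using wR(1) w by (auto intro!: word_cong monomial_cong)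
        have "word n ?y w = word n ?y p * word n ?y (b # q)"
          unfolding w by (rule word_append, rule y, unfold wR(2)[symmetric] w) auto
        then show ?thesis
          using ev[of ?y n, OF y] ab by (simp add: pq R)
      qed
      have "(\<Sum>\<beta>\<in>B. monomial n (x(a := \<beta>, b := D \<beta>)) T) =
          (\<Sum>\<beta>\<in>B. mat_trace (\<beta> * (word n x p * (D \<beta> * word n x q)))) * monomial n x R"
        unfolding sum_distrib_right
        by (intro sum.cong refl key casimir_carrier[OF cas])
      also have "\<dots> = (mat_trace (word n x p) * mat_trace (word n x q) -
          mat_trace (word n x p * word n x q) / of_nat n) * monomial n x R"
        using casimir_cut[OF cas P Q] by simp
      also have "\<dots> = monomial n x (p # q # R) - monomial n (x(a := 1\<^sub>m n, b := 1\<^sub>m n)) T / of_nat n"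
        using P Q by (simp add: key left_diff_distrib)
      finally show "(\<Sum>\<beta>\<in>B. monomial n (x(a := \<beta>, b := D \<beta>)) T) =
          monomial n x (p # q # R) - monomial n (x(a := 1\<^sub>m n, b := 1\<^sub>m n)) T / of_nat n" .
    qed
  next
    case False
    then have "distinct (concat R)" "b \<in> set (concat R)" using wR b ab by auto
    then obtain w' R' where wR': "distinct (b # w' @ concat R')"
      "set (b # w' @ concat R') = set (concat R)" "length R = Suc (length R')"
      and ev': "\<And>n (x :: nat \<Rightarrow> 'a mat). (\<And>i. i \<in> set (concat R) \<Longrightarrow> x i \<in> carrier_mat n n) \<Longrightarrow>
        monomial n x R = mat_trace (x b * word n x w') * monomial n x R'"
      by (rule monomial_isolate[where ?'a = 'a]) blast
    have sets: "set (concat T) = insert a (insert b (set w \<union> set w' \<union> set (concat R')))"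
      unfolding wR(2)[symmetric] using wR'(2) by auto
    have dis: "distinct (a # b # w @ w' @ concat R')"
    proof -
      have R: "set (concat R) = insert b (set w' \<union> set (concat R'))" using wR'(2) by simp
      have "distinct (a # w)" "set (a # w) \<inter> set (concat R) = {}" using wR(1) by auto
      then show ?thesis using wR'(1) unfolding R by auto
    qed
    show thesis
    proof (rule that[of "(w @ w') # R'"])
      show "distinct (concat ((w @ w') # R'))" "length ((w @ w') # R') \<le> Suc (length T)"
        "set (concat ((w @ w') # R')) = set (concat T) - {a, b}"
        using dis wR(3) wR'(3) unfolding sets by auto
      fix n B and D :: "'a mat \<Rightarrow> 'a mat" and x :: "nat \<Rightarrow> 'a mat"
      assume cas: "casimir n B D"
        and x: "\<And>i. i \<in> set (concat T) - {a, b} \<Longrightarrow> x i \<in> carrier_mat n n"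
      have mem: "i \<in> set (concat T) - {a, b}" if "i \<in> set w \<union> set w'" for i
        using that dis unfolding sets by auto
      note P = word_carrier[of w x n, OF x, OF mem, OF UnI1]
        and Q = word_carrier[of w' x n, OF x, OF mem, OF UnI2]
      have key: "monomial n (x(a := \<beta>, b := \<gamma>)) T =
          mat_trace (\<beta> * word n x w) * mat_trace (\<gamma> * word n x w') * monomial n x R'"
        if "\<beta> \<in> carrier_mat n n" "\<gamma> \<in> carrier_mat n n" for \<beta> \<gamma>
      proof -
        let ?y = "x(a := \<beta>, b := \<gamma>)"
        have y: "?y i \<in> carrier_mat n n" if "i \<in> set (concat T)" for i
          using that x[of i] \<open>\<beta> \<in> _\<close> \<open>\<gamma> \<in> _\<close> by auto
        have ww: "word n ?y w = word n x w" "word n ?y w' = word n x w'"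
          and R: "monomial n ?y R' = monomial n x R'"
          using dis by (auto intro!: word_cong monomial_cong)
        have yR: "?y i \<in> carrier_mat n n" if "i \<in> set (concat R)" for i
          by (rule y) (use that wR(2) in auto)
        show ?thesis
          using ev[of ?y n, OF y] ev'[of ?y n, OF yR] ab by (simp add: ww R)
      qed
      have "(\<Sum>\<beta>\<in>B. monomial n (x(a := \<beta>, b := D \<beta>)) T) =
          (\<Sum>\<beta>\<in>B. mat_trace (\<beta> * word n x w) * mat_trace (D \<beta> * word n x w')) * monomial n x R'"
        unfolding sum_distrib_right
        by (intro sum.cong refl key casimir_carrier[OF cas])
      also have "\<dots> = (mat_trace (word n x w * word n x w') -
          mat_trace (word n x w) * mat_trace (word n x w') / of_nat n) * monomial n x R'"
        using casimir_join[OF cas P Q] by simp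
      also have "word n x w * word n x w' = word n x (w @ w')"
        by (rule word_append[symmetric]) (rule x[OF mem])
      also have "(mat_trace (word n x (w @ w')) -
          mat_trace (word n x w) * mat_trace (word n x w') / of_nat n) * monomial n x R' =
          monomial n x ((w @ w') # R') - monomial n (x(a := 1\<^sub>m n, b := 1\<^sub>m n)) T / of_nat n"
        using P Q by (simp add: key left_diff_distrib)
      finally show "(\<Sum>\<beta>\<in>B. monomial n (x(a := \<beta>, b := D \<beta>)) T) =
          monomial n x ((w @ w') # R') - monomial n (x(a := 1\<^sub>m n, b := 1\<^sub>m n)) T / of_nat n" .
    qed
  qed
qed

section \<open>Combinations of trace monomials\<close>

definition trace_sum :: "nat \<Rightarrow> (nat \<Rightarrow> 'a::field mat) \<Rightarrow> ('a \<times> nat list list) list \<Rightarrow> 'a" where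
  "trace_sum n x L = (\<Sum>(c, T)\<leftarrow>L. c * monomial n x T)"

text \<open>
  Each monomial uses every index of \<open>I\<close> exactly once; \<open>d\<close> bounds the number of traces, and thereby the
  power of \<open>n\<close> that empty words can contribute.
\<close>

definition multilinear :: "nat \<Rightarrow> nat set \<Rightarrow> ('a \<times> nat list list) list \<Rightarrow> bool" where
  "multilinear d I L \<longleftrightarrow>
     (\<forall>(c, T)\<in>set L. distinct (concat T) \<and> set (concat T) = I \<and> length T \<le> d)"

text \<open>
  The property that removes the \<open>1/n\<close> part of the Casimir tensor. It holds for the form as a whole; its
  individual monomials in general do not have it.
\<close>

definition vanishes_at_one :: "nat \<Rightarrow> nat set \<Rightarrow> ('a::field \<times> nat list list) list \<Rightarrow> bool" where
  "vanishes_at_one n I L \<longleftrightarrow>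
     (\<forall>x. (\<forall>i\<in>I. x i \<in> carrier_mat n n) \<longrightarrow> (\<exists>i\<in>I. x i = 1\<^sub>m n) \<longrightarrow> trace_sum n x L = 0)"

lemma trace_sum_simps [simp]:
  "trace_sum n x [] = 0"
  "trace_sum n x ((c, T) # L) = c * monomial n x T + trace_sum n x L"
  by (simp_all add: trace_sum_def)

lemma trace_sum_contract_defect:
  fixes L :: "('a::field \<times> nat list list) list"
  assumes "multilinear d I L" and ab: "a \<in> I" "b \<in> I" "a \<noteq> b"
  shows "\<exists>L'. multilinear (Suc d) (I - {a, b}) L' \<and>
    (\<forall>n B D. \<forall>x :: nat \<Rightarrow> 'a mat. casimir n B D \<longrightarrow> (\<forall>i\<in>I - {a, b}. x i \<in> carrier_mat n n) \<longrightarrow>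
      (\<Sum>\<beta>\<in>B. trace_sum n (x(a := \<beta>, b := D \<beta>)) L) =
        trace_sum n x L' - trace_sum n (x(a := 1\<^sub>m n, b := 1\<^sub>m n)) L / of_nat n)"
  using assms(1)
proof (induction L)
  case Nil
  show ?case by (rule exI[of _ "[]"]) (simp add: multilinear_def)
next
  case (Cons cT L)
  obtain c T where cT: "cT = (c, T)" by force
  from Cons.prems have T: "distinct (concat T)" "set (concat T) = I" "length T \<le> d"
    and "multilinear d I L" by (auto simp: cT multilinear_def)
  with Cons.IH obtain L' where L': "multilinear (Suc d) (I - {a, b}) L'"
    and evL: "\<And>n B D (x :: nat \<Rightarrow> 'a mat). casimir n B D \<Longrightarrow> (\<forall>i\<in>I - {a, b}. x i \<in> carrier_mat n n) \<Longrightarrow>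
      (\<Sum>\<beta>\<in>B. trace_sum n (x(a := \<beta>, b := D \<beta>)) L) =
        trace_sum n x L' - trace_sum n (x(a := 1\<^sub>m n, b := 1\<^sub>m n)) L / of_nat n"
    by blast
  obtain T' where T': "distinct (concat T')" "set (concat T') = I - {a, b}"
      "length T' \<le> Suc (length T)"
    and evT: "\<And>n B D (x :: nat \<Rightarrow> 'a mat). casimir n B D \<Longrightarrow> (\<And>i. i \<in> I - {a, b} \<Longrightarrow> x i \<in> carrier_mat n n) \<Longrightarrow>
      (\<Sum>\<beta>\<in>B. monomial n (x(a := \<beta>, b := D \<beta>)) T) =
        monomial n x T' - monomial n (x(a := 1\<^sub>m n, b := 1\<^sub>m n)) T / of_nat n"
    by (rule monomial_contract[OF T(1), of a b, where ?'a = 'a, unfolded T(2), OF ab]) blast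
  show ?case
  proof (rule exI[of _ "(c, T') # L'"], intro conjI allI impI)
    show "multilinear (Suc d) (I - {a, b}) ((c, T') # L')"
      using L' T' T(3) by (auto simp: multilinear_def)
    fix n B and D :: "'a mat \<Rightarrow> 'a mat" and x :: "nat \<Rightarrow> 'a mat"
    assume *: "casimir n B D" "\<forall>i\<in>I - {a, b}. x i \<in> carrier_mat n n"
    have "(\<Sum>\<beta>\<in>B. monomial n (x(a := \<beta>, b := D \<beta>)) T) =
        monomial n x T' - monomial n (x(a := 1\<^sub>m n, b := 1\<^sub>m n)) T / of_nat n"
      by (rule evT) (use * in auto)
    with evL[OF *] show "(\<Sum>\<beta>\<in>B. trace_sum n (x(a := \<beta>, b := D \<beta>)) (cT # L)) =
        trace_sum n x ((c, T') # L') - trace_sum n (x(a := 1\<^sub>m n, b := 1\<^sub>m n)) (cT # L) / of_nat n"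
      unfolding cT trace_sum_simps sum.distrib sum_distrib_left[symmetric]
      by (simp add: right_diff_distrib add_divide_distrib)
  qed
qed

text \<open>
  The correction term has the identity as argument, so it vanishes. The result again vanishes at the
  identity, because it is a sum of values of the old form in which the identity is still an argument; this
  allows the contractions to be iterated.
\<close>

lemma trace_sum_contract:
  fixes L :: "('a::field \<times> nat list list) list"
  assumes "multilinear d I L" and ab: "a \<in> I" "b \<in> I" "a \<noteq> b"
  obtains L' where "multilinear (Suc d) (I - {a, b}) L'"
    "\<And>n B D (x :: nat \<Rightarrow> 'a mat). casimir n B D \<Longrightarrow> vanishes_at_one n I L \<Longrightarrow>
      (\<forall>i\<in>I - {a, b}. x i \<in> carrier_mat n n) \<Longrightarrow>
      (\<Sum>\<beta>\<in>B. trace_sum n (x(a := \<beta>, b := D \<beta>)) L) = trace_sum n x L'"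
    "\<And>n B (D :: 'a mat \<Rightarrow> 'a mat). casimir n B D \<Longrightarrow> vanishes_at_one n I L \<Longrightarrow> vanishes_at_one n (I - {a, b}) L'"
proof -
  obtain L' where L': "multilinear (Suc d) (I - {a, b}) L'"
    and ev: "\<And>n B D (x :: nat \<Rightarrow> 'a mat). casimir n B D \<Longrightarrow> (\<forall>i\<in>I - {a, b}. x i \<in> carrier_mat n n) \<Longrightarrow>
      (\<Sum>\<beta>\<in>B. trace_sum n (x(a := \<beta>, b := D \<beta>)) L) =
        trace_sum n x L' - trace_sum n (x(a := 1\<^sub>m n, b := 1\<^sub>m n)) L / of_nat n"
    using trace_sum_contract_defect[OF assms] by blast
  have killed: "trace_sum n (x(a := \<beta>, b := \<gamma>)) L = 0"
    if "vanishes_at_one n I L" "\<forall>i\<in>I - {a, b}. x i \<in> carrier_mat n n"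
      "\<beta> \<in> carrier_mat n n" "\<gamma> \<in> carrier_mat n n" "\<exists>i\<in>I. (x(a := \<beta>, b := \<gamma>)) i = 1\<^sub>m n"
    for n and x :: "nat \<Rightarrow> 'a mat" and \<beta> \<gamma>
    by (rule that(1)[unfolded vanishes_at_one_def, rule_format, OF _ that(5)]) (use that in auto)
  have eq: "(\<Sum>\<beta>\<in>B. trace_sum n (x(a := \<beta>, b := D \<beta>)) L) = trace_sum n x L'"
    if "casimir n B D" "vanishes_at_one n I L" "\<forall>i\<in>I - {a, b}. x i \<in> carrier_mat n n"
    for n B and D :: "'a mat \<Rightarrow> 'a mat" and x :: "nat \<Rightarrow> 'a mat"
  proof -
    have "trace_sum n (x(a := 1\<^sub>m n, b := 1\<^sub>m n)) L = 0"
      by (rule killed[OF that(2,3)]) (use ab in auto)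
    with ev[OF that(1,3)] show ?thesis by simp
  qed
  have "vanishes_at_one n (I - {a, b}) L'" if "casimir n B D" "vanishes_at_one n I L"
    for n B and D :: "'a mat \<Rightarrow> 'a mat"
    unfolding vanishes_at_one_def
  proof (intro allI impI)
    fix x :: "nat \<Rightarrow> 'a mat"
    assume x: "\<forall>i\<in>I - {a, b}. x i \<in> carrier_mat n n" and one: "\<exists>i\<in>I - {a, b}. x i = 1\<^sub>m n"
    have "trace_sum n (x(a := \<beta>, b := D \<beta>)) L = 0" if "\<beta> \<in> B" for \<beta>
      using casimir_carrier[OF \<open>casimir n B D\<close> that] one
      by (intro killed[OF \<open>vanishes_at_one n I L\<close> x]) auto
    then show "trace_sum n x L' = 0" using eq[OF that x] by simp
  qed
  with L' eq show thesis by (rule that)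
qed

section \<open>Expanding nested commutators\<close>

lemma ad_carrier:
  assumes "X \<in> carrier_mat n n" "U \<in> carrier_mat n n"
  shows "ad X U \<in> carrier_mat n n"
  using mult_carrier_mat[OF assms] mult_carrier_mat[OF assms(2,1)] by (simp add: ad_def minus_carrier_mat)

lemma mat_trace_ad:
  assumes "X \<in> carrier_mat n n" "U \<in> carrier_mat n n"
  shows "mat_trace (ad X U) = 0"
  unfolding ad_def using assms
  by (subst mat_trace_diff[of _ n]) (auto simp: mat_trace_mult_comm[OF assms] intro!: mult_carrier_mat[of _ n n])

lemma foldr_ad_carrier:
  assumes "\<And>i. i \<in> set is \<Longrightarrow> x i \<in> carrier_mat n n" "U \<in> carrier_mat n n"
  shows "foldr (\<lambda>i. ad (x i)) is U \<in> carrier_mat n n"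
  using assms by (induction "is") (auto intro: ad_carrier)

lemma foldr_ad_sl:
  assumes "\<And>i. i \<in> set is \<Longrightarrow> x i \<in> carrier_mat n n" "U \<in> carrier_mat n n" "is \<noteq> []"
  shows "foldr (\<lambda>i. ad (x i)) is U \<in> sl n"
proof -
  obtain i "is'" where "is": "is = i # is'" using assms(3) by (cases "is") auto
  have "foldr (\<lambda>i. ad (x i)) is' U \<in> carrier_mat n n"
    by (rule foldr_ad_carrier) (use assms "is" in auto)
  then show ?thesis
    using mat_trace_ad[of "x i" n] ad_carrier[of "x i" n] assms(1) "is" by (simp add: sl_def)
qed

lemma foldr_ad_zero:
  assumes "\<And>i. i \<in> set is \<Longrightarrow> x i \<in> carrier_mat n n"
  shows "foldr (\<lambda>i. ad (x i)) is (0\<^sub>m n n) = 0\<^sub>m n n"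
  using assms
  by (induction "is") (auto simp: ad_def left_mult_zero_mat[of _ n n] right_mult_zero_mat[of _ n n])

text \<open>
  The innermost commutator \<open>[x, 1]\<close> is zero.
\<close>

lemma foldr_ad_one_argument:
  assumes x: "\<And>i. i \<in> set is \<Longrightarrow> x i \<in> carrier_mat n n" and "is \<noteq> []"
  shows "foldr (\<lambda>i. ad (x i)) is (1\<^sub>m n) = 0\<^sub>m n n"
proof -
  obtain "is'" i where "is": "is = is' @ [i]" using assms(2) by (cases "is" rule: rev_cases) auto
  have "ad (x i) (1\<^sub>m n) = 0\<^sub>m n n" using x[of i] "is" by (simp add: ad_def)
  then show ?thesis using foldr_ad_zero[of "is'" x n] x "is" by simp
qed

lemma foldr_ad_one_factor:
  assumes x: "\<And>i. i \<in> set is \<Longrightarrow> x i \<in> carrier_mat n n" and U: "U \<in> carrier_mat n n"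
    and i: "i \<in> set is" "x i = 1\<^sub>m n"
  shows "foldr (\<lambda>i. ad (x i)) is U = 0\<^sub>m n n"
proof -
  obtain u v where "is": "is = u @ i # v" using i(1) by (metis split_list)
  have "foldr (\<lambda>i. ad (x i)) v U \<in> carrier_mat n n"
    by (rule foldr_ad_carrier[OF x U]) (simp add: "is")
  then have "ad (x i) (foldr (\<lambda>i. ad (x i)) v U) = 0\<^sub>m n n" by (simp add: ad_def i(2))
  then show ?thesis using foldr_ad_zero[of u x n] x "is" by simp
qed

text \<open>
  The signed words of the nested commutator \<open>[x\<^sub>i, [x\<^sub>j, \<dots>]]\<close>, in which the index \<open>0\<close> stands for the
  innermost argument.
\<close>

fun ad_words :: "nat list \<Rightarrow> ('a::field \<times> nat list) list" where
  "ad_words [] = [(1, [0])]"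
| "ad_words (i # is) =
     map (\<lambda>(c, w). (c, i # w)) (ad_words is) @ map (\<lambda>(c, w). (- c, w @ [i])) (ad_words is)"

lemma mset_ad_words: "(c, w) \<in> set (ad_words is) \<Longrightarrow> mset w = mset (0 # is)"
  by (induction "is" arbitrary: c w) auto

lemma set_ad_words: "(c, w) \<in> set (ad_words is) \<Longrightarrow> set w = insert 0 (set is)"
  using mset_eq_setD[OF mset_ad_words] by (metis list.simps(15))

lemma set_ad_words_upt:
  assumes "(c, w) \<in> set (ad_words [1..<Suc k])"
  shows "set w = {0..k}"
proof -
  have "insert 0 {1..<Suc k} = {0..k}" by auto
  then show ?thesis using set_ad_words[OF assms] by (simp only: set_upt)
qed

text \<open>
  The expansion is stated under a trace against an arbitrary \<open>Y\<close>, so that in the induction both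
  multiplications by \<open>x\<^sub>i\<close> can be moved into \<open>Y\<close>.
\<close>

lemma mat_trace_foldr_ad:
  fixes x :: "nat \<Rightarrow> 'a::field mat"
  assumes x: "\<And>i. i \<in> insert 0 (set is) \<Longrightarrow> x i \<in> carrier_mat n n" and Y: "Y \<in> carrier_mat n n"
  shows "mat_trace (foldr (\<lambda>i. ad (x i)) is (x 0) * Y) =
    (\<Sum>(c, w)\<leftarrow>ad_words is. c * mat_trace (word n x w * Y))"
  using x Y
proof (induction "is" arbitrary: Y)
  case Nil
  then show ?case by simp
next
  case (Cons i "is")
  have xi: "x i \<in> carrier_mat n n" and x0: "x 0 \<in> carrier_mat n n"
    and x: "\<And>i. i \<in> insert 0 (set is) \<Longrightarrow> x i \<in> carrier_mat n n"
    using Cons.prems by auto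
  note Y = Cons.prems(2)
  let ?Z = "foldr (\<lambda>i. ad (x i)) is (x 0)"
  have Z: "?Z \<in> carrier_mat n n" by (rule foldr_ad_carrier) (use x in auto)
  have W: "word n x w \<in> carrier_mat n n" "word n x (w @ [i]) = word n x w * x i"
    if "(c, w) \<in> set (ad_words is)" for c :: 'a and w
  proof -
    have w: "set w = insert 0 (set is)" by (rule set_ad_words[OF that])
    show "word n x w \<in> carrier_mat n n" by (rule word_carrier) (use w x in auto)
    have "word n x (w @ [i]) = word n x w * word n x [i]"
      by (rule word_append) (use w x xi in auto)
    then show "word n x (w @ [i]) = word n x w * x i" using xi by simp
  qed
  have left: "mat_trace (word n x (i # w) * Y) = mat_trace (word n x w * (Y * x i))"
    if "(c, w) \<in> set (ad_words is)" for c :: 'a and w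
    using mat_trace_mult_comm[of "x i" n "word n x w * Y"] W(1)[OF that] xi Y
    by (simp add: assoc_mult_mat[of _ n n _ n _ n])
  have "mat_trace (ad (x i) ?Z * Y) = mat_trace (x i * (?Z * Y)) - mat_trace (?Z * (x i * Y))"
    unfolding ad_def[of "x i" ?Z] using xi Z Y
    by (simp add: minus_mult_distrib_mat[of _ n n _ _ n] assoc_mult_mat[of _ n n _ n _ n]
        mat_trace_diff[of _ n])
  also have "mat_trace (x i * (?Z * Y)) = mat_trace (?Z * (Y * x i))"
    using mat_trace_mult_comm[of "x i" n "?Z * Y"] xi Z Y
    by (simp add: assoc_mult_mat[of _ n n _ n _ n])
  also have "\<dots> = (\<Sum>(c, w)\<leftarrow>ad_words is. c * mat_trace (word n x w * (Y * x i)))"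
    by (rule Cons.IH[OF x]) (use Y xi in auto)
  also have "\<dots> = (\<Sum>(c, w)\<leftarrow>ad_words is. c * mat_trace (word n x (i # w) * Y))"
    using left by (intro arg_cong[where f = sum_list] map_cong) auto
  also have "mat_trace (?Z * (x i * Y)) = (\<Sum>(c, w)\<leftarrow>ad_words is. c * mat_trace (word n x w * (x i * Y)))"
    by (rule Cons.IH[OF x]) (use Y xi in auto)
  also have "\<dots> = - (\<Sum>(c, w)\<leftarrow>ad_words is. - c * mat_trace (word n x (w @ [i]) * Y))"
    unfolding uminus_sum_list_map using W Y xi
    by (intro arg_cong[where f = sum_list] map_cong) (auto simp: assoc_mult_mat[of _ n n _ n _ n])
  finally show ?case
    by (simp add: comp_def case_prod_beta' del: word_simps)
qed

section \<open>Contracting the trace of nested commutators\<close>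

text \<open>
  The circle of the diagram cut open: this encodes \<open>Tr (ad x\<^sub>1 (\<dots> (ad x\<^sub>k x\<^sub>0)) x\<^sub>k\<^sub>+\<^sub>1)\<close>, and contracting the
  ends \<open>0\<close> and \<open>k + 1\<close> closes it up to the trace of the operator.
\<close>

definition opened_ad_form :: "nat \<Rightarrow> ('a::field \<times> nat list list) list" where
  "opened_ad_form k = map (\<lambda>(c, w). (c, [w @ [Suc k]])) (ad_words [1..<Suc k])"

lemma multilinear_opened_ad_form: "multilinear 1 {0..Suc k} (opened_ad_form k)"
  unfolding multilinear_def
proof (clarify, intro conjI)
  fix c :: 'a and T assume "(c, T) \<in> set (opened_ad_form k)"
  then obtain w where w: "(c, w) \<in> set (ad_words [1..<Suc k])" and T: "T = [w @ [Suc k]]"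
    by (auto simp: opened_ad_form_def)
  have "set w = {0..k}" by (rule set_ad_words_upt[OF w])
  moreover have "distinct w" using mset_eq_imp_distinct_iff[OF mset_ad_words[OF w]] by simp
  ultimately show "distinct (concat T)" "set (concat T) = {0..Suc k}" "length T \<le> 1"
    by (simp_all add: T atLeast0_atMost_Suc)
qed

lemma trace_sum_opened_ad_form:
  fixes x :: "nat \<Rightarrow> 'a::field mat"
  assumes x: "\<And>i. i \<le> Suc k \<Longrightarrow> x i \<in> carrier_mat n n"
  shows "trace_sum n x (opened_ad_form k) =
    mat_trace (foldr (\<lambda>i. ad (x i)) [1..<Suc k] (x 0) * x (Suc k))"
proof -
  have "word n x (w @ [Suc k]) = word n x w * x (Suc k)"
    if "(c, w) \<in> set (ad_words [1..<Suc k])" for c :: 'a and w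
  proof -
    have "set w = {0..k}" by (rule set_ad_words_upt[OF that])
    then have "word n x (w @ [Suc k]) = word n x w * word n x [Suc k]"
      by (intro word_append x) auto
    then show ?thesis using x[of "Suc k"] by simp
  qed
  moreover have "mat_trace (foldr (\<lambda>i. ad (x i)) [1..<Suc k] (x 0) * x (Suc k)) =
      (\<Sum>(c, w)\<leftarrow>ad_words [1..<Suc k]. c * mat_trace (word n x w * x (Suc k)))"
    by (rule mat_trace_foldr_ad) (auto intro!: x)
  ultimately show ?thesis
    unfolding trace_sum_def opened_ad_form_def
    by (auto simp: comp_def case_prod_beta' intro!: arg_cong[where f = sum_list] map_cong simp del: upt_Suc)
qed

text \<open>
  The three kinds of arguments vanish for different reasons: \<open>ad x\<^sub>k 1 = 0\<close> for \<open>x\<^sub>0\<close>, \<open>ad 1 = 0\<close> for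
  \<open>x\<^sub>1, \<dots>, x\<^sub>k\<close>, and tracelessness of commutators for \<open>x\<^sub>k\<^sub>+\<^sub>1\<close>. The first and the last need at least one commutator, hence \<open>k > 0\<close>.
\<close>

lemma vanishes_at_one_opened_ad_form:
  assumes k: "k > 0"
  shows "vanishes_at_one n {0..Suc k} (opened_ad_form k :: ('a::field \<times> _) list)"
  unfolding vanishes_at_one_def
proof (intro allI impI)
  fix x :: "nat \<Rightarrow> 'a mat"
  assume "\<forall>i\<in>{0..Suc k}. x i \<in> carrier_mat n n" and "\<exists>i\<in>{0..Suc k}. x i = 1\<^sub>m n"
  then obtain i where x: "\<And>i. i \<le> Suc k \<Longrightarrow> x i \<in> carrier_mat n n"
    and i: "i \<le> Suc k" "x i = 1\<^sub>m n" by auto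
  let ?Z = "foldr (\<lambda>i. ad (x i)) [1..<Suc k] (x 0)"
  have xs: "x j \<in> carrier_mat n n" if "j \<in> set [1..<Suc k]" for j using that by (intro x) auto
  have ne: "[1..<Suc k] \<noteq> []" using k by simp
  consider "i = 0" | "i \<in> set [1..<Suc k]" | "i = Suc k" using i(1) by fastforce
  then have "mat_trace (?Z * x (Suc k)) = 0"
  proof cases
    case 1
    then have "?Z = 0\<^sub>m n n" using foldr_ad_one_argument[OF xs ne] i(2) by simp
    then show ?thesis using x[of "Suc k"] by (simp add: mat_trace_zero del: upt_Suc)
  next
    case 2
    have "?Z = 0\<^sub>m n n" by (rule foldr_ad_one_factor[where i = i]) (use 2 i(2) xs x in auto)
    then show ?thesis using x[of "Suc k"] by (simp add: mat_trace_zero del: upt_Suc)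
  next
    case 3
    have "?Z \<in> sl n" by (rule foldr_ad_sl) (use xs x ne in auto)
    then show ?thesis using 3 i(2) by (simp add: sl_def right_mult_one_mat[of _ n n] del: upt_Suc)
  qed
  then show "trace_sum n x (opened_ad_form k) = 0"
    by (simp only: trace_sum_opened_ad_form[OF x])
qed

text \<open>
  Closing the opened form along its two ends. \<open>L\<close> depends on \<open>k\<close> alone; the basis \<open>B\<close> only witnesses that
  \<open>sl n\<close> has a finite basis, so that \<open>operator_trace\<close> is computed in one.
\<close>

lemma ad_form_trace_sum:
  assumes k: "k > 0"
  obtains L :: "('a::field_char_0 \<times> nat list list) list" where "multilinear 2 {1..k} L"
    "\<And>n B. n > 0 \<Longrightarrow> is_finite_basis (sl_vs n :: ('a, 'a mat) module) B \<Longrightarrow> vanishes_at_one n {1..k} L"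
    "\<And>n B x. n > 0 \<Longrightarrow> is_finite_basis (sl_vs n :: ('a, 'a mat) module) B \<Longrightarrow>
       (\<forall>i\<in>{1..k}. x i \<in> carrier_mat n n) \<Longrightarrow> ad_form n k x = trace_sum n x L"
proof -
  have I: "{0..Suc k} - {0, Suc k} = {1..k}" by auto
  obtain L :: "('a \<times> nat list list) list" where L: "multilinear (Suc 1) {1..k} L"
    and ev: "\<And>n B D x. casimir n B D \<Longrightarrow> vanishes_at_one n {0..Suc k} (opened_ad_form k :: ('a \<times> _) list) \<Longrightarrow>
      (\<forall>i\<in>{1..k}. x i \<in> carrier_mat n n) \<Longrightarrow>
      (\<Sum>\<beta>\<in>B. trace_sum n (x(0 := \<beta>, Suc k := D \<beta>)) (opened_ad_form k)) = trace_sum n x L"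
    and vanishes: "\<And>n B (D :: 'a mat \<Rightarrow> 'a mat). casimir n B D \<Longrightarrow>
      vanishes_at_one n {0..Suc k} (opened_ad_form k :: ('a \<times> _) list) \<Longrightarrow> vanishes_at_one n {1..k} L"
    by (rule trace_sum_contract[OF multilinear_opened_ad_form, of 0 k "Suc k", unfolded I]) auto
  show thesis
  proof (rule that)
    show "multilinear 2 {1..k} L" using L by (simp add: numeral_2_eq_2)
  next
    fix n and B :: "'a mat set"
    assume "n > 0" "is_finite_basis (sl_vs n) B"
    then show "vanishes_at_one n {1..k} L"
      using operator_trace_sl_casimir vanishes vanishes_at_one_opened_ad_form[OF k] by metis
  next
    fix n and B :: "'a mat set" and x :: "nat \<Rightarrow> 'a mat"
    assume n: "n > 0" and B: "is_finite_basis (sl_vs n) B" and x: "\<forall>i\<in>{1..k}. x i \<in> carrier_mat n n"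
    obtain B' and D' :: "'a mat \<Rightarrow> 'a mat" where cas: "casimir n B' D'"
      and tr: "\<And>A. A \<in> B' \<rightarrow> sl n \<Longrightarrow> operator_trace (sl_vs n) A = (\<Sum>b\<in>B'. mat_trace (A b * D' b))"
      by (rule operator_trace_sl_casimir[OF n B]) blast
    have "ad_form n k x = (\<Sum>b\<in>B'. mat_trace (foldr (\<lambda>i. ad (x i)) [1..<Suc k] b * D' b))"
      unfolding ad_form_def using k x casimir_carrier(1)[OF cas]
      by (intro tr Pi_I foldr_ad_sl) auto
    also have "\<dots> = (\<Sum>b\<in>B'. trace_sum n (x(0 := b, Suc k := D' b)) (opened_ad_form k))"
    proof (rule sum.cong[OF refl])
      fix b assume b: "b \<in> B'"
      let ?y = "x(0 := b, Suc k := D' b)"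
      have "foldr (\<lambda>i. ad (x i)) [1..<Suc k] b = foldr (\<lambda>i. ad (?y i)) [1..<Suc k] b"
        by (rule foldr_cong) auto
      moreover have "trace_sum n ?y (opened_ad_form k) =
          mat_trace (foldr (\<lambda>i. ad (?y i)) [1..<Suc k] (?y 0) * ?y (Suc k))"
        using x casimir_carrier[OF cas b] by (intro trace_sum_opened_ad_form) auto
      ultimately show "mat_trace (foldr (\<lambda>i. ad (x i)) [1..<Suc k] b * D' b) =
          trace_sum n ?y (opened_ad_form k)" by simp
    qed
    also have "\<dots> = trace_sum n x L"
      by (rule ev[OF cas vanishes_at_one_opened_ad_form[OF k] x])
    finally show "ad_form n k x = trace_sum n x L" .
  qed
qed

lemma is_pairing_finite: "is_pairing k \<pi> \<Longrightarrow> finite \<pi>"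
  by (rule finite_subset[of _ "Pow {1..k}"]) (auto simp: is_pairing_def)

text \<open>
  The minima of disjoint nonempty sets are distinct.
\<close>

lemma is_pairing_card:
  assumes "is_pairing k \<pi>"
  shows "card \<pi> \<le> k"
proof -
  have Min: "Min P \<in> P" if "P \<in> \<pi>" for P
    using that assms by (intro Min_in) (auto simp: is_pairing_def dest!: bspec intro: card_ge_0_finite)
  have "inj_on Min \<pi>"
  proof (rule inj_onI)
    fix P Q assume "P \<in> \<pi>" "Q \<in> \<pi>" "Min P = Min Q"
    then have "\<not> disjnt P Q" using Min[of P] Min[of Q] by (auto simp: disjnt_def)
    then show "P = Q" using assms \<open>P \<in> \<pi>\<close> \<open>Q \<in> \<pi>\<close>
      unfolding is_pairing_def by (meson pairwiseD)
  qed
  moreover have "Min ` \<pi> \<subseteq> {1..k}" using Min assms unfolding is_pairing_def by blast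
  ultimately show ?thesis using card_inj_on_le[of Min \<pi> "{1..k}"] by simp
qed

text \<open>
  Induction over the pairs contracted so far. The induction hypothesis must carry along that the form
  vanishes at the identity, for which the formula has to cover arbitrary matrices as arguments: the
  identity is not traceless.
\<close>

lemma contract_all_trace_sum:
  assumes k: "k > 0" and \<pi>: "is_pairing k \<pi>"
  obtains L :: "('a::field_char_0 \<times> nat list list) list" where
    "multilinear (card \<pi> + 2) (free_indices k \<pi>) L"
    "\<And>n B D x. n > 0 \<Longrightarrow> is_finite_basis (sl_vs n) B \<Longrightarrow> is_dual_basis n B D \<Longrightarrow>
       (\<forall>i\<in>free_indices k \<pi>. x i \<in> carrier_mat n n) \<Longrightarrow>
       contract_all B D \<pi> (ad_form n k) x = trace_sum n x L"
proof -
  note fold_insert = Finite_Set.comp_fun_commute_on.fold_insert[OF comp_fun_commute_on_contract[OF \<pi>]]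
  have "\<exists>L :: ('a \<times> nat list list) list. multilinear (card \<rho> + 2) (free_indices k \<rho>) L \<and>
      (\<forall>n B D. n > 0 \<longrightarrow> is_finite_basis (sl_vs n) B \<longrightarrow> is_dual_basis n B D \<longrightarrow>
         vanishes_at_one n (free_indices k \<rho>) L \<and>
         (\<forall>x. (\<forall>i\<in>free_indices k \<rho>. x i \<in> carrier_mat n n) \<longrightarrow>
           contract_all B D \<rho> (ad_form n k) x = trace_sum n x L))"
    if "finite \<rho>" "\<rho> \<subseteq> \<pi>" for \<rho>
    using that
  proof (induction \<rho> rule: finite_induct)
    case empty
    have free: "free_indices k {} = {1..k}" by (simp add: free_indices_def)
    obtain L :: "('a \<times> nat list list) list" where "multilinear 2 {1..k} L"
      "\<And>n B. n > 0 \<Longrightarrow> is_finite_basis (sl_vs n :: ('a, 'a mat) module) B \<Longrightarrow> vanishes_at_one n {1..k} L"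
      "\<And>n B x. n > 0 \<Longrightarrow> is_finite_basis (sl_vs n :: ('a, 'a mat) module) B \<Longrightarrow>
         (\<forall>i\<in>{1..k}. x i \<in> carrier_mat n n) \<Longrightarrow> ad_form n k x = trace_sum n x L"
      by (rule ad_form_trace_sum[OF k]) blast
    then show ?case
      unfolding free contract_all_def by (intro exI[of _ L]) (simp add: numeral_2_eq_2)
  next
    case (insert P \<rho>)
    then have "\<rho> \<subseteq> \<pi>" by simp
    from insert.IH[OF this] obtain L :: "('a \<times> nat list list) list" where
      L: "multilinear (card \<rho> + 2) (free_indices k \<rho>) L"
      and vanishes: "\<And>n B (D :: 'a mat \<Rightarrow> 'a mat). n > 0 \<Longrightarrow> is_finite_basis (sl_vs n) B \<Longrightarrow> is_dual_basis n B D \<Longrightarrow>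
        vanishes_at_one n (free_indices k \<rho>) L"
      and ev: "\<And>n B D x. n > 0 \<Longrightarrow> is_finite_basis (sl_vs n) B \<Longrightarrow> is_dual_basis n B D \<Longrightarrow>
        (\<forall>i\<in>free_indices k \<rho>. x i \<in> carrier_mat n n) \<Longrightarrow>
        contract_all B D \<rho> (ad_form n k) x = trace_sum n x L"
      by blast
    define a b where "a = Min P" and "b = Max P"
    have P: "P \<subseteq> {1..k}" "card P = 2" "\<And>Q. Q \<in> \<rho> \<Longrightarrow> P \<inter> Q = {}"
    proof -
      have "P \<in> \<pi>" using insert.prems by simp
      then show "P \<subseteq> {1..k}" "card P = 2" using \<pi> unfolding is_pairing_def by blast+
      fix Q assume "Q \<in> \<rho>"
      then have "Q \<in> \<pi>" "P \<noteq> Q" using insert.prems insert.hyps(2) by auto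
      with \<open>P \<in> \<pi>\<close> \<pi> show "P \<inter> Q = {}"
        unfolding is_pairing_def disjnt_def[symmetric] by (meson pairwiseD)
    qed
    then obtain u v where uv: "P = {u, v}" "u \<noteq> v" by (meson card_2_iff)
    then have ab: "P = {a, b}" "a \<noteq> b" by (auto simp: a_def b_def min_def max_def)
    have mem: "a \<in> free_indices k \<rho>" "b \<in> free_indices k \<rho>"
      using P ab by (auto simp: free_indices_def)
    have free: "free_indices k \<rho> - {a, b} = free_indices k (insert P \<rho>)"
      using ab by (auto simp: free_indices_def)
    obtain L' :: "('a \<times> nat list list) list" where
      L': "multilinear (Suc (card \<rho> + 2)) (free_indices k (insert P \<rho>)) L'"
      and ev': "\<And>n B D x. casimir n B D \<Longrightarrow> vanishes_at_one n (free_indices k \<rho>) L \<Longrightarrow>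
        (\<forall>i\<in>free_indices k (insert P \<rho>). x i \<in> carrier_mat n n) \<Longrightarrow>
        (\<Sum>\<beta>\<in>B. trace_sum n (x(a := \<beta>, b := D \<beta>)) L) = trace_sum n x L'"
      and vanishes': "\<And>n B (D :: 'a mat \<Rightarrow> 'a mat). casimir n B D \<Longrightarrow>
        vanishes_at_one n (free_indices k \<rho>) L \<Longrightarrow> vanishes_at_one n (free_indices k (insert P \<rho>)) L'"
      by (rule trace_sum_contract[OF L mem ab(2), unfolded free]) blast
    show ?case
    proof (rule exI[of _ L'], intro conjI allI impI)
      show "multilinear (card (insert P \<rho>) + 2) (free_indices k (insert P \<rho>)) L'"
        using L' insert.hyps by simp
      fix n B and D :: "'a mat \<Rightarrow> 'a mat"
      assume H: "n > 0" "is_finite_basis (sl_vs n) B" "is_dual_basis n B D"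
      note cas = casimir_dual_basis[OF H]
      show "vanishes_at_one n (free_indices k (insert P \<rho>)) L'"
        by (rule vanishes'[OF cas vanishes[OF H]])
      fix x :: "nat \<Rightarrow> 'a mat"
      assume x: "\<forall>i\<in>free_indices k (insert P \<rho>). x i \<in> carrier_mat n n"
      have "contract_all B D (insert P \<rho>) (ad_form n k) =
          contract B D P (contract_all B D \<rho> (ad_form n k))"
        unfolding contract_all_def by (rule fold_insert[OF insert.prems insert.hyps])
      then have "contract_all B D (insert P \<rho>) (ad_form n k) x =
          (\<Sum>\<beta>\<in>B. contract_all B D \<rho> (ad_form n k) (x(a := \<beta>, b := D \<beta>)))"
        by (simp add: contract_def a_def b_def)
      also have "\<dots> = (\<Sum>\<beta>\<in>B. trace_sum n (x(a := \<beta>, b := D \<beta>)) L)"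
        using x casimir_carrier[OF cas] unfolding free[symmetric]
        by (intro sum.cong refl ev[OF H]) auto
      also have "\<dots> = trace_sum n x L'"
        by (rule ev'[OF cas vanishes[OF H] x])
      finally show "contract_all B D (insert P \<rho>) (ad_form n k) x = trace_sum n x L'" .
    qed
  qed
  from this[OF is_pairing_finite[OF \<pi>] subset_refl] show thesis
    by (elim exE conjE) (rule that, assumption, simp)
qed

section \<open>Collecting powers of the matrix size\<close>

text \<open>
  Empty words are removed from a monomial and recorded as the exponent of \<open>n\<close>.
\<close>

definition strip :: "nat list list \<Rightarrow> letter list list" where
  "strip T = map (map Plain) (filter (\<lambda>w. w \<noteq> []) T)"

definition loops :: "nat list list \<Rightarrow> nat" where
  "loops T = length (filter (\<lambda>w. w = []) T)"

lemma monomial_strip: "monomial n x T = of_nat n ^ loops T * eval_trace_expr n x (strip T)"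
proof (induction T)
  case (Cons w T)
  have "word_mat n x (map Plain w) = word n x w"
    by (simp add: word_mat_def word_def foldr_map comp_def)
  with Cons show ?case
    by (auto simp: strip_def loops_def eval_trace_expr_def mat_trace_one)
qed (simp add: strip_def loops_def eval_trace_expr_def)

text \<open>
  Distinct monomials may agree after the removal of empty words, so their coefficients are added.
\<close>

definition collected_coeff :: "('a::field \<times> nat list list) list \<Rightarrow> letter list list \<Rightarrow> 'a poly" where
  "collected_coeff L U = (\<Sum>(c, T)\<leftarrow>L. if strip T = U then monom c (loops T) else 0)"

lemma trace_sum_collected:
  assumes "finite S" "strip ` snd ` set L \<subseteq> S"
  shows "trace_sum n x L =
    (\<Sum>U\<in>S. poly (collected_coeff L U) (of_nat n) * eval_trace_expr n x U)"
  using assms(2)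
proof (induction L)
  case (Cons cT L)
  obtain c T where cT: "cT = (c, T)" by force
  have "(\<Sum>U\<in>S. poly (collected_coeff (cT # L) U) (of_nat n) * eval_trace_expr n x U) =
      (\<Sum>U\<in>S. (if U = strip T then c * of_nat n ^ loops T * eval_trace_expr n x U else 0) +
        poly (collected_coeff L U) (of_nat n) * eval_trace_expr n x U)"
    by (intro sum.cong refl) (auto simp: cT collected_coeff_def poly_monom algebra_simps)
  also have "\<dots> = c * monomial n x T + trace_sum n x L"
    using Cons assms(1) by (simp add: cT sum.distrib monomial_strip)
  finally show ?case by (simp add: cT)
qed (simp add: collected_coeff_def)

lemma degree_collected_coeff:
  assumes "\<And>c T. (c, T) \<in> set L \<Longrightarrow> length T \<le> d"
  shows "degree (collected_coeff L U) \<le> d"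
  using assms
proof (induction L)
  case (Cons cT L)
  obtain c T where cT: "cT = (c, T)" by force
  have "loops T \<le> d" using Cons.prems[of c T] length_filter_le[of _ T] cT
    unfolding loops_def by (meson list.set_intros(1) order_trans)
  then have "degree (if strip T = U then monom c (loops T) else 0) \<le> d"
    using degree_monom_le[of c "loops T"] by auto
  moreover have "degree (collected_coeff L U) \<le> d"
    by (rule Cons.IH) (use Cons.prems in auto)
  ultimately show ?case by (simp add: cT collected_coeff_def degree_add_le)
qed (simp add: collected_coeff_def)

lemma is_trace_expr_strip:
  assumes "set (concat T) = I"
  shows "is_trace_expr I (strip T)"
  using assms by (auto simp: is_trace_expr_def strip_def)

text \<open>
  Here the form to be contracted is \<open>Tr (x\<^sub>0 x\<^sub>1)\<close>, which does not vanish at the identity: the correction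
  term contributes \<open>-n/n\<close>.
\<close>

lemma ad_form_zero:
  assumes n: "n > 0" and B: "is_finite_basis (sl_vs n :: ('a::field_char_0, 'a mat) module) B"
  shows "ad_form n 0 x = (of_nat n ^ 2 - 1 :: 'a)"
proof -
  obtain B' and D' :: "'a mat \<Rightarrow> 'a mat" where cas: "casimir n B' D'" and sub: "B' \<subseteq> sl n"
    and tr: "\<And>A. A \<in> B' \<rightarrow> sl n \<Longrightarrow> operator_trace (sl_vs n) A = (\<Sum>b\<in>B'. mat_trace (A b * D' b))"
    by (rule operator_trace_sl_casimir[OF n B]) blast
  have "ad_form n 0 x = (\<Sum>b\<in>B'. mat_trace (b * D' b))"
    unfolding ad_form_def using sub by (subst tr) auto
  also have "\<dots> = (\<Sum>b\<in>B'. mat_trace (b * (1\<^sub>m n * (D' b * 1\<^sub>m n))))"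
    using casimir_carrier[OF cas] by (intro sum.cong refl)
      (simp add: left_mult_one_mat[of _ n n] right_mult_one_mat[of _ n n])
  also have "\<dots> = of_nat n ^ 2 - 1"
    using n by (subst casimir_cut[OF cas]) (simp_all add: mat_trace_one power2_eq_square)
  finally show ?thesis .
qed

theorem theorem2:
  fixes k :: nat and \<pi> :: "nat set set"
  assumes "is_pairing k \<pi>"
  shows "\<exists>(S :: letter list list set) (p :: letter list list \<Rightarrow> 'a::field_char_0 poly).
    finite S \<and>
    (\<forall>T\<in>S. is_trace_expr (free_indices k \<pi>) T) \<and>
    (\<forall>n\<ge>2. \<forall>B D. \<forall>x :: nat \<Rightarrow> 'a mat.
       is_finite_basis (sl_vs n) B \<longrightarrow> is_dual_basis n B D \<longrightarrow>
       (\<forall>i\<in>free_indices k \<pi>. x i \<in> sl n) \<longrightarrow>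
       contract_all B D \<pi> (ad_form n k) x =
         (\<Sum>T\<in>S. poly (p T) (of_nat n) * eval_trace_expr n x T)) \<and>
    (\<forall>T\<in>S. degree (p T) \<le> k + 2)"
proof (cases "k = 0")
  case True
  with assms have "\<pi> = {}" by (auto simp: is_pairing_def)
  then show ?thesis
    using True
    by (intro exI[of _ "{[]}"] exI[of _ "\<lambda>_. [:-1, 0, 1:]"])
      (auto simp: contract_all_def ad_form_zero is_trace_expr_def eval_trace_expr_def power2_eq_square)
next
  case False
  then obtain L :: "('a \<times> nat list list) list" where
    L: "multilinear (card \<pi> + 2) (free_indices k \<pi>) L"
    and ev: "\<And>n B D x. n > 0 \<Longrightarrow> is_finite_basis (sl_vs n) B \<Longrightarrow> is_dual_basis n B D \<Longrightarrow>
       (\<forall>i\<in>free_indices k \<pi>. x i \<in> carrier_mat n n) \<Longrightarrow>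
       contract_all B D \<pi> (ad_form n k) x = trace_sum n x L"
    using contract_all_trace_sum[OF _ assms, where ?'a = 'a] by blast
  let ?S = "strip ` snd ` set L"
  show ?thesis
  proof (intro exI[of _ ?S] exI[of _ "collected_coeff L"] conjI ballI allI impI)
    fix U assume "U \<in> ?S"
    then show "is_trace_expr (free_indices k \<pi>) U"
      using L by (auto simp: multilinear_def intro!: is_trace_expr_strip)
    have "degree (collected_coeff L U) \<le> card \<pi> + 2"
      by (rule degree_collected_coeff) (use L in \<open>auto simp: multilinear_def\<close>)
    then show "degree (collected_coeff L U) \<le> k + 2"
      using is_pairing_card[OF assms] by simp
  next
    fix n B and D :: "'a mat \<Rightarrow> 'a mat" and x :: "nat \<Rightarrow> 'a mat"
    assume H: "2 \<le> n" "is_finite_basis (sl_vs n) B" "is_dual_basis n B D"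
      "\<forall>i\<in>free_indices k \<pi>. x i \<in> sl n"
    then have "contract_all B D \<pi> (ad_form n k) x = trace_sum n x L"
      by (intro ev) (auto simp: sl_def)
    also have "\<dots> = (\<Sum>U\<in>?S. poly (collected_coeff L U) (of_nat n) * eval_trace_expr n x U)"
      by (rule trace_sum_collected) auto
    finally show "contract_all B D \<pi> (ad_form n k) x =
        (\<Sum>U\<in>?S. poly (collected_coeff L U) (of_nat n) * eval_trace_expr n x U)" .
  qed simp
qed

end
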